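(* Fix a real number $\beta$ with $0\le\beta\le\tfrac12$, and for integers $n\ge 0$ put $$\lambda_n(\beta)=\frac{\sqrt n}{[\log(e+n)]^{\beta}}.$$ There exists a real-valued, continuous and even function $f_\beta:\mathbb R\to\mathbb R$ that is both integrable and square-integrable on $\mathbb R$ such that $$\widehat{f_\beta}=f_\beta,\qquad f_\beta(\lambda_n(\beta))=0\quad\text{for all integers } n\ge0,\qquad f_\beta(\tfrac12)=1.$$
   Context: The Fourier transform is normalized as $\widehat f(\xi)=\int_{\mathbb R}f(x)e^{-2\pi i x\xi}\,dx$. Here $e$ is Euler's number and $\log$ is the natural logarithm. *)

theory Defs
  imports "HOL-Analysis.Analysis"
begin

definition fourier_transform :: "(real \<Rightarrow> complex) \<Rightarrow> real \<Rightarrow> complex" where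
  "fourier_transform f \<xi> =
     (LINT x|lborel. f x * exp (- (2 * complex_of_real pi * \<i> * complex_of_real x * complex_of_real \<xi>)))"

definition lambda_node :: "real \<Rightarrow> nat \<Rightarrow> real" where
  "lambda_node \<beta> n = sqrt (real n) / ln (exp 1 + real n) powr \<beta>"

end

theory Submission
  imports Defs "HOL-Probability.Sinc_Integral" "HOL-Real_Asymp.Real_Asymp"
begin

text \<open>
  Call a function self-dual if it is integrable and equal to its own cosine transform.  Such a
  function is even and continuous, its supremum is at most its \<open>L\<^sup>1\<close> norm, and a series of self-dual
  functions with summable \<open>L\<^sup>1\<close> norms is self-dual again (\<open>self_dual_series\<close>).  The theorem is thus an
  interpolation problem: find a self-dual function that takes the value \<open>1\<close> at \<open>1/2\<close> and \<open>0\<close> at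
  all other prescribed nodes.  Of the nodes only their separation matters: any two nodes in
  \<open>[0, 2^i]\<close> have distance at least \<open>c / (2^i * i)\<close>.  The factor \<open>i\<close> in the denominator is the
  logarithm that \<open>\<beta> \<le> 1/2\<close> allows.

  The building block at a node \<open>l\<close> is a wave packet: two translates by \<open>l\<close> and \<open>- l\<close> of a compactly
  supported bump of width \<open>s\<close>, plus the cosine transform of these bumps, which is
  \<open>2 * s * wave (s * y) * cos (2 * pi * l * y)\<close>.  If \<open>s\<close> is below the gaps between the nodes, the
  bumps alone reproduce arbitrary data exactly, and the error at the nodes comes from the waves
  alone.  A single width per node would give waves that are not small compared with the data in mean
  square.  Therefore every bump is an average of bumps of all the widths \<open>4^(-j)\<close> below the
  gaps, with weights \<open>j^(-\<epsilon>) - (j+1)^(-\<epsilon>)\<close>; their tails telescope to \<open>j^(-\<epsilon>)\<close>, so the data have to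
  be multiplied only by the slowly growing factor \<open>V j = j^\<epsilon>\<close>.

  The layer of width \<open>4^(-j)\<close> is, up to the envelope \<open>wave\<close>, a cosine sum over the nodes below
  \<open>2^j\<close>.  The Fejer kernel is positive and its transform, the triangle, has compact support; so
  separated cosines are exactly orthogonal with this kernel as weight
  (\<open>fejer_quasi_orthogonality\<close>).  A local averaging turns this into a bound
  for the values of a cosine sum at separated points (\<open>large_sieve_cos\<close>).  As \<open>wave\<close> vanishes
  to second order at \<open>0\<close> and decays quadratically, layer \<open>j\<close> acts on the nodes near \<open>2^i\<close> essentially
  only for \<open>i\<close> close to \<open>2 * j\<close>, and there the squares of its values add up to a multiple of
  \<open>j / c\<close> times the squares of its coefficients (\<open>block_bound\<close>).  The factor \<open>j\<close>, which reflects the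
  logarithm in the separation, is compensated by the weights, which are at most \<open>\<epsilon> * j^(-1-\<epsilon>)\<close>.
  After summation over all layers the error is at most \<open>const * \<epsilon> / c\<close> times the data in the mean
  square with weights \<open>V\<close> (\<open>residual_bound\<close>), while the \<open>L\<^sup>1\<close> norms of the weighted layers stay
  summable because \<open>\<epsilon> > 0\<close>.  So for small \<open>\<epsilon>\<close> the packets interpolate up to an error of half
  the size of the data, and iterating on the error gives a geometric series in \<open>L\<^sup>1\<close> whose sum
  interpolates exactly.
\<close>

section \<open>Cosine transforms and self-dual functions\<close>

text \<open>For an even real function this is the Fourier transform with the normalization \<open>exp (- 2 * pi * \<i> * x * \<xi>)\<close>;
  staying with cosines keeps everything real.  A self-dual function is an \<open>f\<close> with
  \<open>has_cos_transform f f\<close>.\<close>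

definition has_cos_transform :: "(real \<Rightarrow> real) \<Rightarrow> (real \<Rightarrow> real) \<Rightarrow> bool" where
  "has_cos_transform f g \<longleftrightarrow>
     integrable lborel f \<and> (\<forall>x. (LINT t|lborel. f t * cos (2 * pi * x * t)) = g x)"

lemma integrable_mult_cos:
  fixes f :: "real \<Rightarrow> real"
  assumes "integrable lborel f"
  shows "integrable lborel (\<lambda>t. f t * cos (a + b * t))"
proof (rule Bochner_Integration.integrable_bound[OF assms])
  show "(\<lambda>t. f t * cos (a + b * t)) \<in> borel_measurable lborel"
    using assms by measurable
  show "AE x in lborel. norm (f x * cos (a + b * x)) \<le> norm (f x)"
    by (intro AE_I2) (simp add: abs_mult mult_left_le)
qed

lemma integrable_mult_sin:
  fixes f :: "real \<Rightarrow> real"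
  assumes "integrable lborel f"
  shows "integrable lborel (\<lambda>t. f t * sin (a + b * t))"
proof -
  have "cos (a - pi / 2 + b * t) = sin (a + b * t)" for t
    using sin_cos_eq[of "a + b * t"] cos_minus[of "a - pi / 2 + b * t"] by (simp add: algebra_simps)
  thus ?thesis using integrable_mult_cos[OF assms, of "a - pi / 2" b] by simp
qed

lemma integral_odd_zero:
  fixes f :: "real \<Rightarrow> real"
  assumes "\<And>t. f (- t) = - f t"
  shows "(LINT t|lborel. f t) = 0"
proof -
  have "(LINT t|lborel. f t) = (LINT t|lborel. f (- t))"
    using lborel_integral_real_affine[of "-1" f 0] by simp
  also have "\<dots> = - (LINT t|lborel. f t)"
    using assms by simp
  finally show ?thesis by simp
qed

text \<open>A phase shift costs only a factor because the sine part of an even function integrates to zero.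
  This computes the transform of a translate.\<close>

lemma integral_even_cos_shift:
  assumes "has_cos_transform f g" and even: "\<And>t. f (- t) = f t"
  shows "(LINT t|lborel. f t * cos (a + 2 * pi * x * t)) = cos a * g x"
proof -
  have int: "integrable lborel f" using assms(1) by (simp add: has_cos_transform_def)
  have "(LINT t|lborel. f t * cos (a + 2 * pi * x * t))
      = (LINT t|lborel. cos a * (f t * cos (2 * pi * x * t)) - sin a * (f t * sin (2 * pi * x * t)))"
    by (intro Bochner_Integration.integral_cong) (auto simp: cos_add algebra_simps)
  also have "\<dots> = cos a * (LINT t|lborel. f t * cos (2 * pi * x * t)) 
        - sin a * (LINT t|lborel. f t * sin (2 * pi * x * t))"
    using integrable_mult_cos[OF int, of 0] integrable_mult_sin[OF int, of 0]
    by (subst Bochner_Integration.integral_diff) auto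
  also have "(LINT t|lborel. f t * sin (2 * pi * x * t)) = 0"
    by (rule integral_odd_zero) (simp add: even)
  also have "(LINT t|lborel. f t * cos (2 * pi * x * t)) = g x"
    using assms(1) by (simp add: has_cos_transform_def)
  finally show ?thesis by simp
qed

lemma has_cos_transform_add:
  assumes "has_cos_transform f g" "has_cos_transform f' g'"
  shows "has_cos_transform (\<lambda>t. f t + f' t) (\<lambda>x. g x + g' x)"
  using assms integrable_mult_cos[of f 0] integrable_mult_cos[of f' 0] 
  by (auto simp: has_cos_transform_def distrib_right)

lemma has_cos_transform_scale:
  assumes "has_cos_transform f g"
  shows "has_cos_transform (\<lambda>t. c * f t) (\<lambda>x. c * g x)"
  using assms by (auto simp: has_cos_transform_def mult.assoc)

lemma has_cos_transform_sum:
  assumes "finite A" "\<And>i. i \<in> A \<Longrightarrow> has_cos_transform (f i) (g i)"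
  shows "has_cos_transform (\<lambda>t. \<Sum>i\<in>A. f i t) (\<lambda>x. \<Sum>i\<in>A. g i x)"
  using assms
proof (induction A rule: finite_induct)
  case empty
  then show ?case by (simp add: has_cos_transform_def)
next
  case (insert a A)
  then show ?case by (simp add: has_cos_transform_add)
qed

lemma has_cos_transform_dilate:
  assumes "has_cos_transform f g" "s > 0"
  shows "has_cos_transform (\<lambda>t. f (s * t)) (\<lambda>x. g (x / s) / s)"
  unfolding has_cos_transform_def
proof safe
  show "integrable lborel (\<lambda>t. f (s * t))"
    using assms lborel_integrable_real_affine[of f s 0] by (simp add: has_cos_transform_def)
  fix x
  have "g (x / s) = (LINT t|lborel. f t * cos (2 * pi * (x / s) * t))"
    using assms unfolding has_cos_transform_def by metis
  also have "\<dots> = s * (LINT t|lborel. f (s * t) * cos (2 * pi * x * t))"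
    using assms(2) by (subst lborel_integral_real_affine[of s _ 0]) (auto simp: field_simps)
  finally show "(LINT t|lborel. f (s * t) * cos (2 * pi * x * t)) = g (x / s) / s"
    using assms(2) by (simp add: field_simps)
qed

text \<open>If \<open>f\<close> and \<open>g\<close> are transforms of each other, the bumps at \<open>l\<close> and \<open>- l\<close> and the modulated copy of \<open>g\<close>
  are exchanged by the transform, so their sum is self-dual.\<close>

lemma self_dual_wave_packet:
  assumes fg: "has_cos_transform f g" and gf: "has_cos_transform g f"
    and even: "\<And>t. f (- t) = f t" and s: "s > 0"
  shows "has_cos_transform
           (\<lambda>y. f ((y - l) / s) + f ((y + l) / s) + 2 * s * g (s * y) * cos (2 * pi * l * y))
           (\<lambda>y. f ((y - l) / s) + f ((y + l) / s) + 2 * s * g (s * y) * cos (2 * pi * l * y))"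
    (is "has_cos_transform ?P ?P")
proof -
  have bump: "has_cos_transform (\<lambda>y. f ((y - m) / s)) (\<lambda>x. s * g (s * x) * cos (2 * pi * m * x))" for m
    unfolding has_cos_transform_def
  proof safe
    show "integrable lborel (\<lambda>y. f ((y - m) / s))"
      using fg s lborel_integrable_real_affine[of f "1 / s" "- m / s"] 
      by (simp add: has_cos_transform_def diff_divide_distrib)
    fix x
    have "(LINT y|lborel. f ((y - m) / s) * cos (2 * pi * x * y)) 
      = s * (LINT u|lborel. f u * cos (2 * pi * x * m + 2 * pi * (s * x) * u))"
      using s by (subst lborel_integral_real_affine[of s _ m]) (auto simp: algebra_simps)
    also have "\<dots> = s * g (s * x) * cos (2 * pi * m * x)"
      by (subst integral_even_cos_shift[OF fg even]) (simp add: mult_ac)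
    finally show "(LINT y|lborel. f ((y - m) / s) * cos (2 * pi * x * y)) = s * g (s * x) * cos (2 * pi * m * x)" .
  qed
  have wave: "has_cos_transform (\<lambda>y. 2 * s * g (s * y) * cos (2 * pi * l * y))
      (\<lambda>x. f ((x - l) / s) + f ((x + l) / s))"
    unfolding has_cos_transform_def
  proof safe
    have gs: "has_cos_transform (\<lambda>y. g (s * y)) (\<lambda>x. f (x / s) / s)"
      by (rule has_cos_transform_dilate[OF gf s])
    hence int: "integrable lborel (\<lambda>y. g (s * y))" by (simp add: has_cos_transform_def)
    show "integrable lborel (\<lambda>y. 2 * s * g (s * y) * cos (2 * pi * l * y))"
      using integrable_mult_right[OF integrable_mult_cos[OF int, of 0 "2 * pi * l"], of "2 * s"]
      by (simp add: mult_ac)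
    fix x
    have "(LINT y|lborel. 2 * s * g (s * y) * cos (2 * pi * l * y) * cos (2 * pi * x * y))
       = (LINT y|lborel. s * (g (s * y) * cos (2 * pi * (x - l) * y)) + s * (g (s * y) * cos (2 * pi * (x + l) * y)))"
    proof (intro Bochner_Integration.integral_cong refl)
      fix y
      have "2 * (cos (2 * pi * l * y) * cos (2 * pi * x * y)) = cos (2 * pi * (x - l) * y) + cos (2 * pi * (x + l) * y)"
        unfolding cos_times_cos by (simp add: algebra_simps cos_diff cos_add)
      thus "2 * s * g (s * y) * cos (2 * pi * l * y) * cos (2 * pi * x * y) 
        = s * (g (s * y) * cos (2 * pi * (x - l) * y)) + s * (g (s * y) * cos (2 * pi * (x + l) * y))"
        by algebra
    qed
    also have "\<dots> = s * (LINT y|lborel. g (s * y) * cos (2 * pi * (x - l) * y)) + 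
       s * (LINT y|lborel. g (s * y) * cos (2 * pi * (x + l) * y))"
      using integrable_mult_cos[OF int, of 0 "2 * pi * (x - l)"] integrable_mult_cos[OF int, of 0 "2 * pi * (x + l)"]
      by (subst Bochner_Integration.integral_add) auto
    also have "\<dots> = f ((x - l) / s) + f ((x + l) / s)"
      using gs s by (simp add: has_cos_transform_def)
    finally show "(LINT y|lborel. 2 * s * g (s * y) * cos (2 * pi * l * y) * cos (2 * pi * x * y))
      = f ((x - l) / s) + f ((x + l) / s)" .
  qed
  have "has_cos_transform ?P (\<lambda>x. (s * g (s * x) * cos (2 * pi * l * x) + s * g (s * x) * cos (2 * pi * (- l) * x))
     + (f ((x - l) / s) + f ((x + l) / s)))"
    using has_cos_transform_add[OF has_cos_transform_add[OF bump[of l] bump[of "- l"]] wave] by simp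
  thus ?thesis by (simp add: add_ac mult_ac)
qed

lemma abs_le_integral_abs:
  assumes "has_cos_transform f g"
  shows "\<bar>g x\<bar> \<le> (LINT t|lborel. \<bar>f t\<bar>)"
proof -
  have int: "integrable lborel f" using assms by (simp add: has_cos_transform_def)
  have "\<bar>g x\<bar> = \<bar>LINT t|lborel. f t * cos (2 * pi * x * t)\<bar>"
    using assms by (simp add: has_cos_transform_def)
  also have "\<dots> \<le> (LINT t|lborel. \<bar>f t * cos (2 * pi * x * t)\<bar>)"
    by (rule integral_abs_bound)
  also have "\<dots> \<le> (LINT t|lborel. \<bar>f t\<bar>)"
    using integrable_abs[OF integrable_mult_cos[OF int, of 0 "2 * pi * x"]] int
    by (intro integral_mono) (auto simp: abs_mult mult_left_le)
  finally show ?thesis .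
qed

lemma has_cos_transform_even:
  assumes "has_cos_transform f g"
  shows "g (- x) = g x"
proof -
  have "g (- x) = (LINT t|lborel. f t * cos (2 * pi * (- x) * t))"
    using assms unfolding has_cos_transform_def by metis
  also have "\<dots> = g x" using assms by (simp add: has_cos_transform_def)
  finally show ?thesis .
qed

lemma has_cos_transform_continuous:
  assumes "has_cos_transform f g"
  shows "continuous_on UNIV g"
proof -
  have int: "integrable lborel f" using assms by (simp add: has_cos_transform_def)
  have meas [measurable]: "f \<in> borel_measurable borel" using int by (simp add: borel_measurable_integrable)
  have "isCont g x" for x
    unfolding continuous_at_sequentially
  proof safe
    fix u :: "nat \<Rightarrow> real" assume u: "u \<longlonglongrightarrow> x"
    have "(\<lambda>k. LINT t|lborel. f t * cos (2 * pi * u k * t)) \<longlonglongrightarrow> (LINT t|lborel. f t * cos (2 * pi * x * t))"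
    proof (rule integral_dominated_convergence[where w="\<lambda>t. \<bar>f t\<bar>"])
      show "AE t in lborel. (\<lambda>k. f t * cos (2 * pi * u k * t)) \<longlonglongrightarrow> f t * cos (2 * pi * x * t)"
        by (intro AE_I2 tendsto_intros u)
    qed (use int in \<open>auto simp: abs_mult mult_left_le\<close>)
    thus "(g \<circ> u) \<longlonglongrightarrow> g x" using assms by (simp add: has_cos_transform_def o_def)
  qed
  thus ?thesis by (simp add: continuous_at_imp_continuous_on)
qed

text \<open>A self-dual function is bounded by its \<open>L\<^sup>1\<close> norm, so summable norms also give absolute and uniform
  convergence, and dominated convergence lets the transform pass through the series.  Both infinite
  sums of functions below, over the scales and over the iterations, are of this kind.\<close>

lemma self_dual_series:
  assumes f: "\<And>k. has_cos_transform (f k) (f k)"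
    and sm: "summable (\<lambda>k. LINT t|lborel. \<bar>f k t\<bar>)"
  shows "has_cos_transform (\<lambda>x. \<Sum>k. f k x) (\<lambda>x. \<Sum>k. f k x)"
    and "(LINT x|lborel. \<bar>\<Sum>k. f k x\<bar>) \<le> (\<Sum>k. LINT t|lborel. \<bar>f k t\<bar>)"
    and "summable (\<lambda>k. \<bar>f k x\<bar>)"
proof -
  have int: "integrable lborel (f k)" for k using f[of k] by (simp add: has_cos_transform_def)
  have sx: "summable (\<lambda>k. \<bar>f k x\<bar>)" for x
    by (rule summable_comparison_test'[OF sm, of 0]) (use abs_le_integral_abs[OF f] in auto)
  show "summable (\<lambda>k. \<bar>f k x\<bar>)" by (rule sx)
  have I: "integrable lborel (\<lambda>x. \<Sum>k. f k x)"
    by (rule integrable_suminf) (use int sx sm in auto)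
  show "has_cos_transform (\<lambda>x. \<Sum>k. f k x) (\<lambda>x. \<Sum>k. f k x)"
    unfolding has_cos_transform_def
  proof safe
    show "integrable lborel (\<lambda>x. \<Sum>k. f k x)" by (rule I)
    fix x
    have "(LINT t|lborel. (\<Sum>k. f k t) * cos (2 * pi * x * t)) = (LINT t|lborel. (\<Sum>k. f k t * cos (2 * pi * x * t)))"
      using summable_rabs_cancel[OF sx] by (simp add: suminf_mult2)
    also have "\<dots> = (\<Sum>k. LINT t|lborel. f k t * cos (2 * pi * x * t))"
    proof (rule integral_suminf)
      show "integrable lborel (\<lambda>t. f k t * cos (2 * pi * x * t))" for k
        using integrable_mult_cos[OF int, of k 0] by simp
      show "AE t in lborel. summable (\<lambda>k. norm (f k t * cos (2 * pi * x * t)))"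
      proof (rule AE_I2)
        fix t
        show "summable (\<lambda>k. norm (f k t * cos (2 * pi * x * t)))"
          by (rule summable_comparison_test'[OF sx[of t], of 0]) (auto simp: abs_mult mult_left_le)
      qed
      show "summable (\<lambda>k. LINT t|lborel. norm (f k t * cos (2 * pi * x * t)))"
      proof (rule summable_comparison_test'[OF sm, of 0])
        fix k
        have "(LINT t|lborel. norm (f k t * cos (2 * pi * x * t))) \<le> (LINT t|lborel. \<bar>f k t\<bar>)"
          using integrable_norm[OF integrable_mult_cos[OF int, of k 0 "2 * pi * x"]] int[of k]
          by (intro integral_mono) (auto simp: abs_mult mult_left_le)
        thus "norm (LINT t|lborel. norm (f k t * cos (2 * pi * x * t))) \<le> (LINT t|lborel. \<bar>f k t\<bar>)"
          by simp
      qed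
    qed
    also have "\<dots> = (\<Sum>k. f k x)" using f by (simp add: has_cos_transform_def)
    finally show "(LINT t|lborel. (\<Sum>k. f k t) * cos (2 * pi * x * t)) = (\<Sum>k. f k x)" .
  qed
  have "(LINT x|lborel. \<bar>\<Sum>k. f k x\<bar>) \<le> (LINT x|lborel. (\<Sum>k. \<bar>f k x\<bar>))"
    by (intro integral_mono integrable_suminf)
       (use I int sx sm in \<open>auto intro: summable_rabs\<close>)
  also have "\<dots> = (\<Sum>k. LINT t|lborel. \<bar>f k t\<bar>)"
    by (rule integral_suminf) (use int sx sm in auto)
  finally show "(LINT x|lborel. \<bar>\<Sum>k. f k x\<bar>) \<le> (\<Sum>k. LINT t|lborel. \<bar>f k t\<bar>)" .
qed

section \<open>The triangle and the Fejer kernel\<close>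

text \<open>The function \<open>Si (2 * x) - sin x * sinc x\<close> is an antiderivative of \<open>sinc x ^ 2\<close>, which reduces the integral
  to the limit of \<open>Si\<close> at infinity.  At \<open>0\<close> its derivative has to be taken from the definition,
  since \<open>sinc\<close> is given by cases there.\<close>

lemma has_bochner_integral_sinc_squared:
  "has_bochner_integral lborel (\<lambda>x. (sinc x)\<^sup>2) pi"
proof -
  define F where "F x = Si (2 * x) - sin x * sinc x" for x
  have dF: "(F has_real_derivative (sinc x)\<^sup>2) (at x)" for x
  proof -
    have Si2: "((\<lambda>x. Si (2 * x)) has_real_derivative sinc (2 * x) * 2) (at x)"
      by (rule DERIV_chain2[OF DERIV_Si]) (auto intro!: derivative_eq_intros)
    have "((\<lambda>x. sin x * sinc x) has_real_derivative sinc (2 * x) * 2 - (sinc x)\<^sup>2) (at x)"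
    proof (cases "x = 0")
      case True
      have "(\<lambda>h. sinc h * sinc h) \<midarrow>0\<rightarrow> sinc 0 * sinc 0"
        using isCont_sinc[of 0] unfolding isCont_def by (intro tendsto_intros)
      moreover have "eventually (\<lambda>h. sinc h * sinc h = (sin h * sinc h - sin 0 * sinc 0) / h) (at 0)"
        unfolding eventually_at_filter by (auto simp: )
      ultimately have "(\<lambda>h. (sin h * sinc h - sin 0 * sinc 0) / h) \<midarrow>0\<rightarrow> sinc 0 * sinc 0"
        by (rule Lim_transform_eventually)
      thus ?thesis using True by (simp only: DERIV_def add_0_left) simp
    next
      case False
      have "((\<lambda>x. sin x * (sin x / x)) has_real_derivative sinc (2 * x) * 2 - (sinc x)\<^sup>2) (at x)"
        using False sin_double[of x, unfolded mult.commute[of 2 x]]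
        by (auto intro!: derivative_eq_intros simp: field_simps power2_eq_square)
      thus ?thesis
      proof (rule has_field_derivative_transform_within_open[of _ _ _ "- {0}"])
      qed (use False in auto)
    qed
    from DERIV_diff[OF Si2 this] show ?thesis by (simp add: F_def[abs_def])
  qed
  have lim: "(F \<longlongrightarrow> pi / 2) at_top"
  proof -
    have 1: "((\<lambda>x. Si (2 * x)) \<longlongrightarrow> pi / 2) at_top"
      by (rule filterlim_compose[OF Si_at_top]) real_asymp
    have 2: "((\<lambda>x. sin x * sinc x) \<longlongrightarrow> 0) at_top"
    proof (rule Lim_null_comparison)
      show "eventually (\<lambda>x. norm (sin x * sinc x) \<le> 1 / x) at_top"
        using eventually_gt_at_top[of "0::real"]
      proof eventually_elim
        case (elim x)
        have "\<bar>sin x\<bar> * \<bar>sin x\<bar> \<le> 1" by (intro mult_le_one) auto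
        thus ?case using elim by (simp add: abs_mult divide_simps)
      qed
      show "((\<lambda>x::real. 1 / x) \<longlongrightarrow> 0) at_top" by real_asymp
    qed
    show ?thesis using tendsto_diff[OF 1 2] by (simp add: F_def[abs_def])
  qed
  have "(\<integral>\<^sup>+x. ennreal ((sinc x)\<^sup>2) * indicator {0 ..} x \<partial>lborel) = pi / 2 - F 0"
    by (rule nn_integral_FTC_atLeast[OF _ dF _ lim]) auto
  also have "(\<lambda>x. ennreal ((sinc x)\<^sup>2) * indicator {0 ..} x) = (\<lambda>x. ennreal (indicator {0..} x *\<^sub>R (sinc x)\<^sup>2))"
    by (auto simp: indicator_def)
  also have "pi / 2 - F 0 = pi / 2"
    by (simp add: F_def Si_def zero_ereal_def[symmetric])
  finally have "has_bochner_integral lborel (\<lambda>x. indicator {0..} x *\<^sub>R (sinc x)\<^sup>2) (pi / 2)"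
  proof (intro has_bochner_integral_nn_integral)
    show "(\<lambda>x. indicator {0..} x *\<^sub>R (sinc x)\<^sup>2) \<in> borel_measurable lborel"
      using borel_measurable_sinc by simp
  qed (simp_all only: scaleR_nonneg_nonneg zero_le_power2 indicator_pos_le pi_half_ge_zero AE_I2)
  from has_bochner_integral_even_function[OF this] show ?thesis by simp
qed

lemma has_bochner_integral_sinc_squared_scaled:
  "has_bochner_integral lborel (\<lambda>t. (a * sinc (a * t))\<^sup>2) (pi * \<bar>a\<bar>)"
proof (cases "a = 0")
  case False
  have "has_bochner_integral lborel (\<lambda>t. (sinc (0 + a * t))\<^sup>2) (pi /\<^sub>R \<bar>a\<bar>)"
    using has_bochner_integral_sinc_squared False
    by (subst (asm) lborel_has_bochner_integral_real_affine_iff[of a _ _ 0]) auto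
  from has_bochner_integral_mult_right[OF this, of "a\<^sup>2"]
  have "has_bochner_integral lborel (\<lambda>t. a\<^sup>2 * (sinc (a * t))\<^sup>2) (a\<^sup>2 * (pi /\<^sub>R \<bar>a\<bar>))"
    by (simp only: add_0_left)
  moreover have "a\<^sup>2 * (pi /\<^sub>R \<bar>a\<bar>) = pi * \<bar>a\<bar>"
    using False by (simp add: field_simps power2_eq_square abs_if)
  ultimately show ?thesis by (simp only: power_mult_distrib)
qed (simp add: has_bochner_integral_zero)

text \<open>This is the hat \<open>max 0 (1 - \<bar>x\<bar>)\<close>, written as a second difference of the absolute value because that
  is the form in which it arises from integrals of the Fejer kernel.\<close>

definition triangle :: "real \<Rightarrow> real" where
  "triangle x = (\<bar>x + 1\<bar> + \<bar>x - 1\<bar>) / 2 - \<bar>x\<bar>"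

definition fejer :: "real \<Rightarrow> real" where
  "fejer x = (sinc (pi * x))\<^sup>2"

text \<open>By the addition theorems, \<open>fejer t * cos (2 * pi * x * t)\<close> is a second difference in \<open>x\<close> of squared,
  scaled \<open>sinc\<close> functions.  Their integrals are multiples of \<open>\<bar>x\<bar>\<close>, and the second difference of
  \<open>\<bar>x\<bar>\<close> is the triangle.\<close>

lemma fejer_cos_transform: "has_cos_transform fejer triangle"
proof -
  have eq: "fejer t * cos (2 * pi * x * t) = 1 / (2 * pi\<^sup>2) *
    ((pi * (x + 1) * sinc (pi * (x + 1) * t))\<^sup>2 + (pi * (x - 1) * sinc (pi * (x - 1) * t))\<^sup>2
       - 2 * (pi * x * sinc (pi * x * t))\<^sup>2)" for x t
  proof (cases "t = 0")
    case True
    then show ?thesis by (simp add: fejer_def field_simps power2_eq_square)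
  next
    case False
    have sq: "(pi * y * sinc (pi * y * t))\<^sup>2 = (1 - cos (2 * pi * y * t)) / (2 * t\<^sup>2)" for y
    proof -
      have "2 * (sin (pi * y * t))\<^sup>2 = 1 - cos (2 * pi * y * t)" 
        using cos_double_sin[of "pi * y * t"] by (simp add: mult_ac)
      thus ?thesis using False by (cases "y = 0") (auto simp: field_simps)
    qed
    have f: "fejer t = (1 - cos (2 * pi * t)) / (2 * pi\<^sup>2 * t\<^sup>2)"
      using sq[of 1] False by (auto simp: fejer_def field_simps)
    have "cos (2 * pi * (x + 1) * t) + cos (2 * pi * (x - 1) * t) = 2 * (cos (2 * pi * t) * cos (2 * pi * x * t))"
      by (simp add: algebra_simps cos_add cos_diff)
    moreover have "(1 - c) / (2 * pi\<^sup>2 * t\<^sup>2) * d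
        = 1 / (2 * pi\<^sup>2) * ((1 - p) / (2 * t\<^sup>2) + (1 - q) / (2 * t\<^sup>2) - 2 * ((1 - d) / (2 * t\<^sup>2)))"
      if "p + q = 2 * (c * d)" for c d p q :: real
    proof -
      have q: "q = 2 * (c * d) - p" using that by simp
      show ?thesis using False unfolding q by (simp add: field_simps)
    qed
    ultimately show ?thesis unfolding sq f by blast
  qed
  have "has_bochner_integral lborel (\<lambda>t. fejer t * cos (2 * pi * x * t)) (triangle x)" for x
  proof -
    have "has_bochner_integral lborel (\<lambda>t. fejer t * cos (2 * pi * x * t)) 
       (1 / (2 * pi\<^sup>2) * (pi * \<bar>pi * (x + 1)\<bar> + pi * \<bar>pi * (x - 1)\<bar> - 2 * (pi * \<bar>pi * x\<bar>)))"
      unfolding eq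
      by (intro has_bochner_integral_mult_right has_bochner_integral_add has_bochner_integral_diff has_bochner_integral_sinc_squared_scaled)
    also have "1 / (2 * pi\<^sup>2) * (pi * \<bar>pi * (x + 1)\<bar> + pi * \<bar>pi * (x - 1)\<bar> - 2 * (pi * \<bar>pi * x\<bar>)) = triangle x"
    proof -
      have "1 / (2 * pi\<^sup>2) * (pi * (pi * a) + pi * (pi * b) - 2 * (pi * (pi * c))) = (a + b) / 2 - c" for a b c
        by (simp add: power2_eq_square field_simps)
      from this[of "\<bar>x + 1\<bar>" "\<bar>x - 1\<bar>" "\<bar>x\<bar>"] show ?thesis
        unfolding triangle_def abs_mult abs_of_pos[OF pi_gt_zero] .
    qed
    finally show ?thesis .
  qed
  from this this[of 0] show ?thesis
    by (auto simp: has_cos_transform_def has_bochner_integral_iff)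
qed

lemma triangle_cos_transform: "has_cos_transform triangle fejer"
proof -
  have "has_bochner_integral lborel (\<lambda>t. triangle t * cos (2 * pi * x * t)) (fejer x)" for x
  proof -
    have even: "triangle (- t) * cos (2 * pi * x * (- t)) = triangle t * cos (2 * pi * x * t)" for t
      by (simp add: triangle_def abs_minus_commute) (simp add: abs_if)
    have half: "indicator {0..} t *\<^sub>R (triangle t * cos (2 * pi * x * t)) = indicator {0..1} t *\<^sub>R ((1 - t) * cos (2 * pi * x * t))" for t
      by (auto simp: indicator_def triangle_def)
    have "has_bochner_integral lborel (\<lambda>t. indicator {0..1} t *\<^sub>R ((1 - t) * cos (2 * pi * x * t))) (fejer x / 2)"
    proof (cases "x = 0")
      case True
      have "has_bochner_integral lborel (\<lambda>t. ((1 - t) * cos (2 * pi * x * t)) * indicator {0..1} t) ((1 - 1\<^sup>2 / 2) - (0 - 0\<^sup>2 / 2))"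
        by (rule has_bochner_integral_FTC_Icc_real)
           (use True in \<open>auto intro!: derivative_eq_intros continuous_intros\<close>)
      thus ?thesis using True by (simp add: fejer_def mult_ac)
    next
      case False
      define F where "F t = (1 - t) * sin (2 * pi * x * t) / (2 * pi * x) - cos (2 * pi * x * t) / (2 * pi * x)\<^sup>2" for t
      have "has_bochner_integral lborel (\<lambda>t. ((1 - t) * cos (2 * pi * x * t)) * indicator {0..1} t) (F 1 - F 0)"
        unfolding F_def
        by (rule has_bochner_integral_FTC_Icc_real)
           (use False in \<open>auto intro!: derivative_eq_intros continuous_intros simp: field_simps power2_eq_square\<close>)
      also have "F 1 - F 0 = fejer x / 2"
      proof -
        have "F 1 - F 0 = (1 - cos (2 * (pi * x))) / (2 * pi * x)\<^sup>2"
          by (simp add: F_def diff_divide_distrib mult_ac)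
        also have "\<dots> = fejer x / 2"
          using False unfolding cos_double_sin
          by (simp add: fejer_def power_mult_distrib power_divide)
        finally show ?thesis .
      qed
      finally show ?thesis by (simp add: mult_ac)
    qed
    from has_bochner_integral_even_function[OF this[folded half] even]
    show ?thesis by simp
  qed
  from this this[of 0] show ?thesis
    by (auto simp: has_cos_transform_def has_bochner_integral_iff)
qed

section \<open>Self-dual wave packets\<close>

text \<open>Two triangles are combined so that the integral of the bump is zero while its value at \<open>0\<close> is \<open>1\<close>.
  The vanishing integral makes the transform \<open>wave\<close> small at low frequencies, and this keeps
  the waves of narrow bumps away from the nodes near the origin.\<close>

definition bump :: "real \<Rightarrow> real" where
  "bump y = 2 * triangle (2 * y) - triangle y"

definition wave :: "real \<Rightarrow> real" where
  "wave x = fejer (x / 2) - fejer x"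

lemma triangle_zero: "1 \<le> \<bar>x\<bar> \<Longrightarrow> triangle x = 0"
  by (auto simp: triangle_def abs_if split: if_splits)

lemma triangle_0 [simp]: "triangle 0 = 1"
  by (simp add: triangle_def)

lemma bump_0 [simp]: "bump 0 = 1"
  by (simp add: bump_def)

lemma bump_zero: "1 \<le> \<bar>y\<bar> \<Longrightarrow> bump y = 0"
  by (simp add: bump_def triangle_zero)

lemma bump_minus: "bump (- y) = bump y"
  by (simp add: bump_def has_cos_transform_even[OF fejer_cos_transform])

lemma bump_cos_transform: "has_cos_transform bump wave"
  using has_cos_transform_add[OF 
      has_cos_transform_scale[OF has_cos_transform_dilate[OF triangle_cos_transform, of 2], of 2]
      has_cos_transform_scale[OF triangle_cos_transform, of "-1"]]
  by (simp add: bump_def[abs_def] wave_def[abs_def])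

lemma wave_cos_transform: "has_cos_transform wave bump"
  using has_cos_transform_add[OF 
      has_cos_transform_dilate[OF fejer_cos_transform, of "1/2"]
      has_cos_transform_scale[OF fejer_cos_transform, of "-1"]]
  by (simp add: bump_def[abs_def] wave_def[abs_def] mult.commute)

lemma abs_sinc_le_1: "\<bar>sinc x\<bar> \<le> 1"
  by (cases "x = 0") (auto simp: abs_sin_x_le_abs_x divide_le_eq)

lemma fejer_nonneg: "0 \<le> fejer x" by (simp add: fejer_def)

text \<open>With \<open>a = pi * x / 2\<close> the difference of Fejer kernels is \<open>(sin a)^4 / a^2\<close>, from which the sign,
  the double zero at \<open>0\<close> and the quadratic decay can be read off.\<close>

lemma wave_eq: "wave x = (sin (pi * x / 2) * sinc (pi * x / 2))\<^sup>2"
proof (cases "x = 0")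
  case True
  then show ?thesis by (simp add: wave_def fejer_def)
next
  case False
  define a where "a = pi * x / 2"
  have a: "a \<noteq> 0" "pi * x = 2 * a" "pi * (x / 2) = a" using False by (auto simp: a_def)
  have "wave x = (sin a)\<^sup>2 / a\<^sup>2 - (2 * sin a * cos a)\<^sup>2 / (2 * a)\<^sup>2"
    using a(1) unfolding wave_def fejer_def a(2,3)
    by (simp add: sin_double power_divide power_mult_distrib)
  also have "\<dots> = (sin a)\<^sup>2 * (1 - (cos a)\<^sup>2) / a\<^sup>2"
    using a(1) by (simp add: field_simps power2_eq_square)
  also have "1 - (cos a)\<^sup>2 = (sin a)\<^sup>2"
    by (simp add: sin_squared_eq)
  also have "(sin a)\<^sup>2 * (sin a)\<^sup>2 / a\<^sup>2 = (sin a * sinc a)\<^sup>2"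
    using a(1) by (simp add: power_mult_distrib power_divide)
  finally show ?thesis by (simp add: a_def)
qed

lemma wave_nonneg: "0 \<le> wave x" by (simp add: wave_eq)

lemma wave_le_fejer: "wave x \<le> fejer (x / 2)"
  by (simp add: wave_def fejer_nonneg)

lemma wave_le_quadratic: "wave x \<le> (pi / 2)\<^sup>2 * x\<^sup>2"
proof -
  have "\<bar>sin (pi * x / 2) * sinc (pi * x / 2)\<bar> \<le> \<bar>pi * x / 2\<bar> * 1"
    unfolding abs_mult by (intro mult_mono abs_sin_x_le_abs_x abs_sinc_le_1) auto
  hence "(sin (pi * x / 2) * sinc (pi * x / 2))\<^sup>2 \<le> (pi * x / 2)\<^sup>2"
    by (simp only: abs_le_square_iff[symmetric] mult_1_right)
  thus ?thesis unfolding wave_eq by (simp add: power_mult_distrib power_divide)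
qed

lemma wave_le_inverse: "x \<noteq> 0 \<Longrightarrow> wave x \<le> (2 / pi)\<^sup>2 / x\<^sup>2"
proof -
  assume x: "x \<noteq> 0"
  have "\<bar>sin (pi * x / 2) * sin (pi * x / 2)\<bar> \<le> 1"
    unfolding abs_mult by (intro mult_le_one) auto
  hence "\<bar>sin (pi * x / 2) * sinc (pi * x / 2)\<bar> \<le> \<bar>2 / pi / x\<bar>"
    using x by (simp add: abs_mult field_simps)
  hence "(sin (pi * x / 2) * sinc (pi * x / 2))\<^sup>2 \<le> (2 / pi / x)\<^sup>2"
    by (simp only: abs_le_square_iff[symmetric])
  hence "wave x \<le> (2 / pi / x)\<^sup>2" by (simp only: wave_eq)
  thus ?thesis by (simp add: power_divide power_mult_distrib)
qed

definition packet :: "real \<Rightarrow> real \<Rightarrow> real \<Rightarrow> real" where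
  "packet s l y = bump ((y - l) / s) + bump ((y + l) / s) + 2 * s * wave (s * y) * cos (2 * pi * l * y)"

lemma packet_self_dual: "s > 0 \<Longrightarrow> has_cos_transform (packet s l) (packet s l)"
  using self_dual_wave_packet[OF bump_cos_transform wave_cos_transform bump_minus]
  unfolding packet_def[abs_def] by blast

section \<open>Quasi-orthogonality and a large sieve for cosine sums\<close>

text \<open>The transform of \<open>fejer (x / T)\<close> vanishes outside \<open>[-1/T, 1/T]\<close>, so the off-diagonal terms of the
  expanded square, which have frequencies \<open>l n - l m\<close> and \<open>l n + l m\<close>, integrate to zero exactly.\<close>

lemma fejer_quasi_orthogonality:
  assumes fin: "finite A" and T: "T > 0"
    and nonneg: "\<And>n. n \<in> A \<Longrightarrow> 0 \<le> l n"
    and sep: "\<And>n m. n \<in> A \<Longrightarrow> m \<in> A \<Longrightarrow> n \<noteq> m \<Longrightarrow> 1 \<le> T * \<bar>l n - l m\<bar>"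
  shows "integrable lborel (\<lambda>x. fejer (x / T) * (\<Sum>n\<in>A. b n * cos (2 * pi * l n * x))\<^sup>2)"
    and "(LINT x|lborel. fejer (x / T) * (\<Sum>n\<in>A. b n * cos (2 * pi * l n * x))\<^sup>2) \<le> T * (\<Sum>n\<in>A. (b n)\<^sup>2)"
proof -
  have K: "has_cos_transform (\<lambda>x. fejer (x / T)) (\<lambda>x. T * triangle (T * x))"
    using has_cos_transform_dilate[OF fejer_cos_transform, of "1 / T"] T by (simp add: mult.commute)
  hence intK: "integrable lborel (\<lambda>x. fejer (x / T))" by (simp add: has_cos_transform_def)
  have "has_bochner_integral lborel (\<lambda>x. fejer (x / T) * cos (2 * pi * y * x)) (T * triangle (T * y))" for y
    using K integrable_mult_cos[OF intK, of 0] by (simp add: has_cos_transform_def has_bochner_integral_iff)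
  note hb = this
  have eq: "fejer (x / T) * (\<Sum>n\<in>A. b n * cos (2 * pi * l n * x))\<^sup>2 =
     (\<Sum>n\<in>A. \<Sum>m\<in>A. b n * b m / 2 * (fejer (x / T) * cos (2 * pi * (l n - l m) * x) + fejer (x / T) * cos (2 * pi * (l n + l m) * x)))" for x
  proof -
    have cc: "cos (2 * pi * l n * x) * cos (2 * pi * l m * x) = (cos (2 * pi * (l n - l m) * x) + cos (2 * pi * (l n + l m) * x)) / 2" for n m
      by (simp add: algebra_simps cos_add cos_diff)
    have prod: "fejer (x / T) * ((b n * cos (2 * pi * l n * x)) * (b m * cos (2 * pi * l m * x)))
      = b n * b m / 2 * (fejer (x / T) * cos (2 * pi * (l n - l m) * x) + fejer (x / T) * cos (2 * pi * (l n + l m) * x))" for n m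
    proof -
      have "fejer (x / T) * ((b n * cos (2 * pi * l n * x)) * (b m * cos (2 * pi * l m * x)))
        = fejer (x / T) * b n * b m * (cos (2 * pi * l n * x) * cos (2 * pi * l m * x))" by simp
      thus ?thesis unfolding cc by (simp add: field_simps)
    qed
    show ?thesis
      unfolding power2_eq_square sum_product unfolding sum_distrib_left
      by (intro sum.cong refl prod)
  qed
  have hbS: "has_bochner_integral lborel (\<lambda>x. fejer (x / T) * (\<Sum>n\<in>A. b n * cos (2 * pi * l n * x))\<^sup>2)
     (\<Sum>n\<in>A. \<Sum>m\<in>A. b n * b m / 2 * (T * triangle (T * (l n - l m)) + T * triangle (T * (l n + l m))))"
    unfolding eq by (intro has_bochner_integral_sum has_bochner_integral_mult_right has_bochner_integral_add hb)
  thus "integrable lborel (\<lambda>x. fejer (x / T) * (\<Sum>n\<in>A. b n * cos (2 * pi * l n * x))\<^sup>2)"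
    by (simp add: has_bochner_integral_iff)
  have tri_le: "triangle x \<le> 1" for x by (auto simp: triangle_def abs_if)
  have inner: "(\<Sum>m\<in>A. b n * b m / 2 * (T * triangle (T * (l n - l m)) + T * triangle (T * (l n + l m)))) \<le> T * (b n)\<^sup>2"
    if n: "n \<in> A" for n
  proof -
    have "(\<Sum>m\<in>A. b n * b m / 2 * (T * triangle (T * (l n - l m)) + T * triangle (T * (l n + l m))))
       = (\<Sum>m\<in>A. if m = n then b n * b n / 2 * (T + T * triangle (T * (l n + l n))) else 0)"
    proof (rule sum.cong[OF refl])
      fix m assume m: "m \<in> A"
      have "triangle (T * (l n - l m)) = 0 \<and> triangle (T * (l n + l m)) = 0" if "m \<noteq> n"
      proof -
        have 1: "1 \<le> T * \<bar>l n - l m\<bar>" using sep n m that by auto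
        also have "\<dots> \<le> T * \<bar>l n + l m\<bar>" 
          using T nonneg[OF n] nonneg[OF m] by (intro mult_left_mono) auto
        finally show ?thesis using 1 T by (auto intro!: triangle_zero simp: abs_mult)
      qed
      thus "b n * b m / 2 * (T * triangle (T * (l n - l m)) + T * triangle (T * (l n + l m))) =
         (if m = n then b n * b n / 2 * (T + T * triangle (T * (l n + l n))) else 0)"
        by auto
    qed
    also have "\<dots> = b n * b n / 2 * (T + T * triangle (T * (l n + l n)))"
      using n fin by simp
    also have "\<dots> \<le> b n * b n / 2 * (T + T * 1)"
      using tri_le T by (intro mult_left_mono add_mono) auto
    finally show ?thesis by (simp add: power2_eq_square mult_ac)
  qed
  have "(LINT x|lborel. fejer (x / T) * (\<Sum>n\<in>A. b n * cos (2 * pi * l n * x))\<^sup>2) 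
     = (\<Sum>n\<in>A. \<Sum>m\<in>A. b n * b m / 2 * (T * triangle (T * (l n - l m)) + T * triangle (T * (l n + l m))))"
    using hbS by (simp add: has_bochner_integral_iff)
  also have "\<dots> \<le> (\<Sum>n\<in>A. T * (b n)\<^sup>2)" by (intro sum_mono inner)
  finally show "(LINT x|lborel. fejer (x / T) * (\<Sum>n\<in>A. b n * cos (2 * pi * l n * x))\<^sup>2) \<le> T * (\<Sum>n\<in>A. (b n)\<^sup>2)"
    by (simp add: sum_distrib_left)
qed

text \<open>The constant \<open>1/2\<close> is that of the cosine at \<open>pi / 3\<close>: the function \<open>sin x - x / 2\<close> increases as long as
  \<open>cos x \<ge> 1 / 2\<close>.\<close>

lemma sinc_ge_half:
  assumes "\<bar>x\<bar> \<le> pi / 3"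
  shows "1 / 2 \<le> sinc x"
proof -
  have pos: "1 / 2 \<le> sinc x" if x: "0 \<le> x" "x \<le> pi / 3" for x
  proof (cases "x = 0")
    case False
    have "sin 0 - 0 / 2 \<le> sin x - x / 2"
    proof (rule DERIV_nonneg_imp_nondecreasing[OF x(1)])
      fix y assume y: "0 \<le> y" "y \<le> x"
      have "cos (pi / 3) \<le> cos y"
        using y x by (intro cos_monotone_0_pi_le) auto
      hence "0 \<le> cos y - 1 / 2" by (simp add: cos_60)
      moreover have "((\<lambda>x. sin x - x / 2) has_real_derivative cos y - 1 / 2) (at y)"
        by (auto intro!: derivative_eq_intros)
      ultimately show "\<exists>D. ((\<lambda>x. sin x - x / 2) has_real_derivative D) (at y) \<and> 0 \<le> D" by blast
    qed
    thus ?thesis using False x by (simp add: field_simps)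
  qed simp
  show ?thesis
  proof (cases "0 \<le> x")
    case True
    thus ?thesis using pos[of x] assms by simp
  next
    case False
    thus ?thesis using pos[of "- x"] assms by simp
  qed
qed

lemma fejer_ge_quarter: "\<bar>x\<bar> \<le> 1 / 3 \<Longrightarrow> 1 / 4 \<le> fejer x"
proof -
  assume x: "\<bar>x\<bar> \<le> 1 / 3"
  have "1 / 2 \<le> sinc (pi * x)" by (rule sinc_ge_half) (use x in \<open>simp add: abs_mult\<close>)
  hence "(1 / 2)\<^sup>2 \<le> (sinc (pi * x))\<^sup>2" by (intro power_mono) auto
  thus ?thesis unfolding fejer_def by (simp add: power2_eq_square)
qed

lemma has_bochner_integral_cos_window:
  assumes "w > 0"
  shows "has_bochner_integral lborel (\<lambda>y. indicator {x - w / 2..x + w / 2} y * cos (2 * pi * l * y))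
           (w * sinc (pi * l * w) * cos (2 * pi * l * x))"
proof (cases "l = 0")
  case True
  have "has_bochner_integral lborel (\<lambda>y. 1 * indicator {x - w / 2..x + w / 2} y) ((x + w / 2) - (x - w / 2))"
    by (rule has_bochner_integral_FTC_Icc_real) (use assms in \<open>auto intro!: derivative_eq_intros\<close>)
  thus ?thesis using True by simp
next
  case False
  have "has_bochner_integral lborel (\<lambda>y. cos (2 * pi * l * y) * indicator {x - w / 2..x + w / 2} y)
     (sin (2 * pi * l * (x + w / 2)) / (2 * pi * l) - sin (2 * pi * l * (x - w / 2)) / (2 * pi * l))"
    by (rule has_bochner_integral_FTC_Icc_real)
       (use assms False in \<open>auto intro!: derivative_eq_intros continuous_intros simp: field_simps\<close>)
  also have "sin (2 * pi * l * (x + w / 2)) / (2 * pi * l) - sin (2 * pi * l * (x - w / 2)) / (2 * pi * l)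
     = (2 * (sin (pi * l * w) * cos (2 * pi * l * x))) / (2 * pi * l)"
  proof -
    have e: "2 * pi * l * (x + w / 2) = 2 * pi * l * x + pi * l * w" "2 * pi * l * (x - w / 2) = 2 * pi * l * x - pi * l * w"
      by (simp_all add: field_simps)
    show ?thesis unfolding diff_divide_distrib[symmetric] e sin_add sin_diff by (simp add: algebra_simps)
  qed
  also have "\<dots> = w * sinc (pi * l * w) * cos (2 * pi * l * x)"
    using False assms by simp
  finally show ?thesis by (simp only: mult.commute)
qed

text \<open>Jensen's inequality for the mean \<open>s\<close> of \<open>g\<close> over an interval, from expanding the integral of
  \<open>(g y - s)^2\<close>.\<close>

lemma square_mean_le:
  fixes g :: "real \<Rightarrow> real"
  assumes cont: "continuous_on UNIV g" and ab: "a < b"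
    and mean: "has_bochner_integral lborel (\<lambda>y. indicator {a..b} y * g y) ((b - a) * s)"
  shows "integrable lborel (\<lambda>y. indicator {a..b} y * (g y)\<^sup>2)"
    and "(b - a) * s\<^sup>2 \<le> (LINT y|lborel. indicator {a..b} y * (g y)\<^sup>2)"
proof -
  have "set_integrable lborel {a..b} (\<lambda>y. (g y)\<^sup>2)"
    by (intro borel_integrable_atLeastAtMost' continuous_intros continuous_on_subset[OF cont]) auto
  thus int: "integrable lborel (\<lambda>y. indicator {a..b} y * (g y)\<^sup>2)"
    by (simp add: set_integrable_def)
  have one: "has_bochner_integral lborel (\<lambda>y. indicator {a..b} y :: real) (b - a)"
    using ab by (auto simp: has_bochner_integral_iff)
  have hb: "has_bochner_integral lborel 
     (\<lambda>y. (indicator {a..b} y * (g y)\<^sup>2 - 2 * s * (indicator {a..b} y * g y)) + s\<^sup>2 * indicator {a..b} y)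
     (((LINT y|lborel. indicator {a..b} y * (g y)\<^sup>2) - 2 * s * ((b - a) * s)) + s\<^sup>2 * (b - a))"
    by (intro has_bochner_integral_add has_bochner_integral_diff has_bochner_integral_mult_right mean one has_bochner_integral_integrable int)
  have "0 \<le> (indicator {a..b} y * (g y)\<^sup>2 - 2 * s * (indicator {a..b} y * g y)) + s\<^sup>2 * indicator {a..b} y" for y
  proof -
    have "0 \<le> indicator {a..b} y * (g y - s)\<^sup>2" by simp
    thus ?thesis by (simp add: power2_diff algebra_simps)
  qed
  note nonneg = this
  have "0 \<le> (LINT y|lborel. (indicator {a..b} y * (g y)\<^sup>2 - 2 * s * (indicator {a..b} y * g y)) + s\<^sup>2 * indicator {a..b} y)"
    by (rule Bochner_Integration.integral_nonneg) (rule nonneg)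
  also note has_bochner_integral_integral_eq[OF hb]
  finally show "(b - a) * s\<^sup>2 \<le> (LINT y|lborel. indicator {a..b} y * (g y)\<^sup>2)"
    by (simp add: power2_eq_square algebra_simps)
qed

text \<open>A window average multiplies the cosine of frequency \<open>l n\<close> by \<open>sinc (pi * l n * w)\<close>, which is at least
  \<open>1/2\<close> for the frequencies in question.  Dividing the coefficients by these factors exhibits the
  value of the sum at a point as the average over a window around it of a sum with coefficients at most
  twice as large.  The windows around the sample points are disjoint, so the squares of the averages
  add up to an integral that quasi-orthogonality controls; no derivative of the sum is needed.\<close>

lemma large_sieve_cos:
  assumes fin: "finite A" "finite M" and T: "T > 0" and w: "w > 0"
    and nonneg: "\<And>n. n \<in> A \<Longrightarrow> 0 \<le> l n"
    and freq: "\<And>n. n \<in> A \<Longrightarrow> l n * w \<le> 1 / 3"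
    and sepA: "\<And>n m. n \<in> A \<Longrightarrow> m \<in> A \<Longrightarrow> n \<noteq> m \<Longrightarrow> 1 \<le> T * \<bar>l n - l m\<bar>"
    and range: "\<And>m. m \<in> M \<Longrightarrow> \<bar>x m\<bar> + w / 2 \<le> T / 3"
    and sepM: "\<And>m m'. m \<in> M \<Longrightarrow> m' \<in> M \<Longrightarrow> m \<noteq> m' \<Longrightarrow> w < \<bar>x m - x m'\<bar>"
  shows "(\<Sum>m\<in>M. (\<Sum>n\<in>A. b n * cos (2 * pi * l n * x m))\<^sup>2) \<le> 16 * T / w * (\<Sum>n\<in>A. (b n)\<^sup>2)"
proof -
  define b' where "b' n = b n / sinc (pi * l n * w)" for n
  define S where "S y = (\<Sum>n\<in>A. b n * cos (2 * pi * l n * y))" for y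
  define S' where "S' y = (\<Sum>n\<in>A. b' n * cos (2 * pi * l n * y))" for y
  have sinc: "1 / 2 \<le> sinc (pi * l n * w)" if "n \<in> A" for n
  proof (rule sinc_ge_half)
    have "pi * (l n * w) \<le> pi * (1 / 3)" using freq[OF that] by (intro mult_left_mono) auto
    thus "\<bar>pi * l n * w\<bar> \<le> pi / 3" using nonneg[OF that] w by (simp add: abs_mult)
  qed
  have b': "b' n * sinc (pi * l n * w) = b n" "(b' n)\<^sup>2 \<le> 4 * (b n)\<^sup>2" if "n \<in> A" for n
  proof -
    have s: "1 / 2 \<le> sinc (pi * l n * w)" by (rule sinc[OF that])
    show "b' n * sinc (pi * l n * w) = b n" using s unfolding b'_def by (simp only: nonzero_eq_divide_eq[symmetric])
    hence "(b n)\<^sup>2 = (b' n)\<^sup>2 * (sinc (pi * l n * w))\<^sup>2" by (metis power_mult_distrib)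
    moreover have "(1 / 2)\<^sup>2 \<le> (sinc (pi * l n * w))\<^sup>2" using s by (intro power_mono) auto
    hence "(b' n)\<^sup>2 * (1 / 2)\<^sup>2 \<le> (b' n)\<^sup>2 * (sinc (pi * l n * w))\<^sup>2" by (intro mult_left_mono) auto
    hence "(b' n)\<^sup>2 \<le> 4 * ((b' n)\<^sup>2 * (sinc (pi * l n * w))\<^sup>2)"
      by (simp only: power_divide) simp
    ultimately show "(b' n)\<^sup>2 \<le> 4 * (b n)\<^sup>2" by (simp only:)
  qed
  have cont: "continuous_on UNIV S'" unfolding S'_def[abs_def] by (intro continuous_intros)
  define I where "I m = {x m - w / 2..x m + w / 2}" for m
  have mean: "has_bochner_integral lborel (\<lambda>y. indicator (I m) y * S' y) ((x m + w / 2 - (x m - w / 2)) * S (x m))" for m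
  proof -
    have "has_bochner_integral lborel (\<lambda>y. \<Sum>n\<in>A. b' n * (indicator (I m) y * cos (2 * pi * l n * y)))
       (\<Sum>n\<in>A. b' n * (w * sinc (pi * l n * w) * cos (2 * pi * l n * x m)))"
      unfolding I_def
      by (intro has_bochner_integral_sum has_bochner_integral_mult_right has_bochner_integral_cos_window w)
    also have "(\<lambda>y. \<Sum>n\<in>A. b' n * (indicator (I m) y * cos (2 * pi * l n * y))) = (\<lambda>y. indicator (I m) y * S' y)"
      by (simp add: S'_def sum_distrib_left mult_ac)
    also have "(\<Sum>n\<in>A. b' n * (w * sinc (pi * l n * w) * cos (2 * pi * l n * x m))) = (\<Sum>n\<in>A. w * (b n * cos (2 * pi * l n * x m)))"
    proof (rule sum.cong[OF refl])
      fix n assume "n \<in> A"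
      hence "b n = b' n * sinc (pi * l n * w)" using b'(1) by metis
      thus "b' n * (w * sinc (pi * l n * w) * cos (2 * pi * l n * x m)) = w * (b n * cos (2 * pi * l n * x m))"
        by (simp only: mult_ac)
    qed
    also have "\<dots> = (x m + w / 2 - (x m - w / 2)) * S (x m)"
      by (simp add: S_def sum_distrib_left)
    finally show ?thesis .
  qed
  have ab: "x m - w / 2 < x m + w / 2" for m using w by simp
  note sq = square_mean_le[OF cont ab mean[unfolded I_def], folded I_def]
  note qo = fejer_quasi_orthogonality[where l = l and b = b', OF fin(1) T nonneg sepA, folded S'_def]
  have ind: "(\<Sum>m\<in>M. indicator (I m) y) \<le> 4 * fejer (y / T)" for y
  proof (cases "\<exists>m\<in>M. y \<in> I m")
    case True
    then obtain m where m: "m \<in> M" "y \<in> I m" by blast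
    have "(\<Sum>m\<in>M. indicator (I m) y) = (\<Sum>m'\<in>M. if m' = m then 1 else 0 :: real)"
    proof (rule sum.cong[OF refl])
      fix m' assume m': "m' \<in> M"
      have "y \<notin> I m'" if "m' \<noteq> m"
        using sepM[OF m(1) m'] that m(2) by (auto simp: I_def abs_if split: if_splits)
      thus "indicator (I m') y = (if m' = m then 1 else 0 :: real)" using m by auto
    qed
    also have "\<dots> = 1" using m(1) fin(2) by simp
    also have "1 \<le> 4 * fejer (y / T)"
    proof -
      have "\<bar>y\<bar> \<le> \<bar>x m\<bar> + w / 2" using m(2) by (auto simp: I_def abs_if)
      also have "\<dots> \<le> T / 3" by (rule range[OF m(1)])
      finally have "\<bar>y / T\<bar> \<le> 1 / 3" using T by (simp add: field_simps)
      from fejer_ge_quarter[OF this] show ?thesis by simp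
    qed
    finally show ?thesis .
  next
    case False
    hence "(\<Sum>m\<in>M. indicator (I m) y) = (0::real)" by (intro sum.neutral) auto
    thus ?thesis using fejer_nonneg by simp
  qed
  have "w * (\<Sum>m\<in>M. (S (x m))\<^sup>2) = (\<Sum>m\<in>M. (x m + w / 2 - (x m - w / 2)) * (S (x m))\<^sup>2)"
    by (simp add: sum_distrib_left)
  also have "\<dots> \<le> (\<Sum>m\<in>M. LINT y|lborel. indicator (I m) y * (S' y)\<^sup>2)"
    by (intro sum_mono sq(2))
  also have "\<dots> = (LINT y|lborel. (\<Sum>m\<in>M. indicator (I m) y * (S' y)\<^sup>2))"
    by (intro Bochner_Integration.integral_sum[symmetric] sq(1))
  also have "\<dots> \<le> (LINT y|lborel. 4 * (fejer (y / T) * (S' y)\<^sup>2))"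
  proof (intro integral_mono)
    show "integrable lborel (\<lambda>y. \<Sum>m\<in>M. indicator (I m) y * (S' y)\<^sup>2)"
      by (intro Bochner_Integration.integrable_sum sq(1))
    show "integrable lborel (\<lambda>y. 4 * (fejer (y / T) * (S' y)\<^sup>2))" using qo(1) by simp
    show "(\<Sum>m\<in>M. indicator (I m) y * (S' y)\<^sup>2) \<le> 4 * (fejer (y / T) * (S' y)\<^sup>2)" for y
      using mult_right_mono[OF ind[of y], of "(S' y)\<^sup>2"] by (simp add: sum_distrib_right mult.assoc)
  qed
  also have "\<dots> \<le> 4 * (T * (\<Sum>n\<in>A. (b' n)\<^sup>2))" using qo(2) by simp
  also have "\<dots> \<le> 4 * (T * (\<Sum>n\<in>A. 4 * (b n)\<^sup>2))"
    using T by (intro mult_left_mono sum_mono b') auto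
  finally show ?thesis using w by (simp add: S_def sum_distrib_left[symmetric] field_simps)
qed

section \<open>Layers of wave packets over separated nodes\<close>

text \<open>The distance between \<open>i\<close> and \<open>2 * j\<close>: the waves of bumps of width \<open>4^(-j)\<close> live near \<open>4^j = 2^(2*j)\<close>, whereas nodes
  are sorted by the powers \<open>2^i\<close>.\<close>

definition scale_gap :: "nat \<Rightarrow> nat \<Rightarrow> nat" where
  "scale_gap i j = (i - 2 * j) + (2 * j - i)"

lemma sum_power_inj_le:
  fixes p :: real
  assumes p: "0 \<le> p" "p < 1" and fin: "finite J" and inj: "inj_on g J"
  shows "(\<Sum>j\<in>J. p ^ g j) \<le> 1 / (1 - p)"
proof -
  have "(\<Sum>j\<in>J. p ^ g j) = (\<Sum>k\<in>g ` J. p ^ k)"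
    by (simp add: sum.reindex[OF inj])
  also have "\<dots> \<le> (\<Sum>k. p ^ k)"
    by (rule sum_le_suminf) (use p fin in \<open>auto intro: summable_geometric\<close>)
  also have "\<dots> = 1 / (1 - p)" using p by (intro suminf_geometric) auto
  finally show ?thesis .
qed

lemma sum_scale_gap_le:
  fixes p :: real
  assumes p: "0 \<le> p" "p < 1" and fin: "finite J"
  shows "(\<Sum>j\<in>J. p ^ scale_gap i j) \<le> 2 / (1 - p)"
    and "(\<Sum>i\<in>J. p ^ scale_gap i j) \<le> 2 / (1 - p)"
proof -
  have split: "(\<Sum>k\<in>J. p ^ g k) \<le> 2 / (1 - p)" 
    if "inj_on g {k\<in>J. P k}" "inj_on g {k\<in>J. \<not> P k}" for g :: "nat \<Rightarrow> nat" and P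
  proof -
    have "(\<Sum>k\<in>J. p ^ g k) = (\<Sum>k\<in>{k\<in>J. P k}. p ^ g k) + (\<Sum>k\<in>{k\<in>J. \<not> P k}. p ^ g k)"
      using fin by (subst sum.union_disjoint[symmetric]) (auto intro!: sum.cong)
    also have "\<dots> \<le> 1 / (1 - p) + 1 / (1 - p)"
      by (intro add_mono sum_power_inj_le p that) (use fin in auto)
    finally show ?thesis by simp
  qed
  show "(\<Sum>j\<in>J. p ^ scale_gap i j) \<le> 2 / (1 - p)"
    by (rule split[of "\<lambda>j. scale_gap i j" "\<lambda>j. i \<le> 2 * j"]) (auto simp: inj_on_def scale_gap_def)
  show "(\<Sum>i\<in>J. p ^ scale_gap i j) \<le> 2 / (1 - p)"
    by (rule split[of "\<lambda>i. scale_gap i j" "\<lambda>i. i \<le> 2 * j"]) (auto simp: inj_on_def scale_gap_def)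
qed

text \<open>The scale \<open>j0\<close> is so large that bumps of width \<open>4^(-j)\<close> with \<open>j \<ge> j0\<close> at nodes below \<open>2^j\<close> do not reach other nodes,
  even those slightly above \<open>2^j\<close>, whence the exponent \<open>j + 1\<close>.  The node \<open>0\<close> keeps the bumps at \<open>l\<close> and
  \<open>- l\<close> apart for all other nodes.\<close>

locale separated_nodes =
  fixes l :: "nat \<Rightarrow> real" and c :: real and j0 :: nat and \<epsilon> :: real
  assumes nonneg: "0 \<le> l n"
    and zero_node: "\<exists>n. l n = 0"
    and c: "0 < c" "c \<le> 1"
    and gap: "n \<noteq> m \<Longrightarrow> l n \<le> 2 ^ i \<Longrightarrow> l m \<le> 2 ^ i \<Longrightarrow> 1 \<le> i \<Longrightarrow> c / (2 ^ i * real i) \<le> \<bar>l n - l m\<bar>"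
    and j0: "1 \<le> j0" "j0 \<le> j \<Longrightarrow> 2 ^ (j + 1) * real (j + 1) \<le> c * 4 ^ j"
    and \<epsilon>: "0 < \<epsilon>" "\<epsilon> \<le> 1"
begin

text \<open>The first scale at which bumps at the node are narrow enough.\<close>

definition level :: "nat \<Rightarrow> nat" where
  "level n = (LEAST j. j0 \<le> j \<and> l n \<le> 2 ^ j)"

text \<open>The weights are the decrements of \<open>tail\<close>, so those from scale \<open>j\<close> on add up to \<open>tail j\<close>, and multiplication by \<open>V j\<close>
  normalizes the sum to \<open>1\<close>.\<close>

definition V :: "nat \<Rightarrow> real" where "V j = real j powr \<epsilon>"

definition tail :: "nat \<Rightarrow> real" where "tail j = real j powr (- \<epsilon>)"

definition weight :: "nat \<Rightarrow> real" where "weight j = tail j - tail (j + 1)"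

definition active :: "nat \<Rightarrow> nat set" where "active j = {n. level n \<le> j}"

definition energy :: "(nat \<Rightarrow> real) \<Rightarrow> nat \<Rightarrow> real" where
  "energy d j = (\<Sum>n\<in>active j. (V (level n) * d n)\<^sup>2)"

text \<open>The bumps at \<open>l\<close> and \<open>- l\<close> coincide for the node \<open>0\<close>, which is why its coefficient is halved.\<close>

definition coef :: "(nat \<Rightarrow> real) \<Rightarrow> nat \<Rightarrow> real" where
  "coef d n = (if l n = 0 then 1 / 2 else 1) * (V (level n) * d n)"

text \<open>All wave packets of width \<open>4^(-j)\<close>; the definition of \<open>spill\<close> isolates their wave part, which is the only
  source of error at the nodes.\<close>

definition layer :: "(nat \<Rightarrow> real) \<Rightarrow> nat \<Rightarrow> real \<Rightarrow> real" where
  "layer d j y = (\<Sum>n\<in>active j. coef d n * packet (1 / 4 ^ j) (l n) y)"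

definition spill :: "(nat \<Rightarrow> real) \<Rightarrow> nat \<Rightarrow> real \<Rightarrow> real" where
  "spill d j y = 2 / 4 ^ j * wave (y / 4 ^ j) * (\<Sum>n\<in>active j. coef d n * cos (2 * pi * l n * y))"

lemma level_le_iff: "level n \<le> j \<longleftrightarrow> j0 \<le> j \<and> l n \<le> 2 ^ j"
proof -
  obtain k :: nat where "l n < 2 ^ k" using real_arch_pow[of 2 "l n"] by auto
  also have "(2::real) ^ k \<le> 2 ^ max k j0" by (intro power_increasing) auto
  finally have ex: "j0 \<le> max k j0 \<and> l n \<le> 2 ^ max k j0" by simp
  have L: "j0 \<le> level n \<and> l n \<le> 2 ^ level n"
    unfolding level_def by (rule LeastI[of "\<lambda>j. j0 \<le> j \<and> l n \<le> 2 ^ j", OF ex])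
  show ?thesis
  proof
    assume le: "level n \<le> j"
    have "(2::real) ^ level n \<le> 2 ^ j" using le by (intro power_increasing) auto
    thus "j0 \<le> j \<and> l n \<le> 2 ^ j" using L le by linarith
  next
    assume "j0 \<le> j \<and> l n \<le> 2 ^ j"
    thus "level n \<le> j" unfolding level_def by (rule Least_le)
  qed
qed

lemma level_ge: "j0 \<le> level n" and l_le_level: "l n \<le> 2 ^ level n"
  using level_le_iff[of n "level n"] by auto

lemma level_pos: "1 \<le> level n" using level_ge[of n] j0(1) by linarith

lemma active_iff: "n \<in> active j \<longleftrightarrow> j0 \<le> j \<and> l n \<le> 2 ^ j"
  by (simp add: active_def level_le_iff)

lemma fine_gap:
  assumes "n \<in> active j" "n \<noteq> m"
  shows "1 \<le> 4 ^ j * \<bar>l n - l m\<bar>"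
proof (cases "l m \<le> 2 ^ (j + 1)")
  case True
  have n: "j0 \<le> j" "l n \<le> 2 ^ j" using assms(1) by (auto simp: active_iff)
  have "l n \<le> 2 ^ (j + 1)" using n(2) by (rule order_trans) simp
  from gap[OF assms(2) this True] have 1: "c / (2 ^ (j + 1) * real (j + 1)) \<le> \<bar>l n - l m\<bar>" by simp
  have "1 \<le> 4 ^ j * (c / (2 ^ (j + 1) * real (j + 1)))"
    using j0(2)[OF n(1)] by (simp add: field_simps del: of_nat_Suc)
  also have "\<dots> \<le> 4 ^ j * \<bar>l n - l m\<bar>" using 1 by (intro mult_left_mono) auto
  finally show ?thesis .
next
  case False
  have n: "l n \<le> 2 ^ j" using assms(1) by (auto simp: active_iff)
  have "1 \<le> (2::real) ^ j" by simp
  also have "\<dots> \<le> \<bar>l n - l m\<bar>" using False n by simp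
  finally have a: "1 \<le> \<bar>l n - l m\<bar>" .
  have "1 * 1 \<le> 4 ^ j * \<bar>l n - l m\<bar>" by (intro mult_mono a) auto
  thus ?thesis by simp
qed

text \<open>Nodes active at scale \<open>j\<close> are \<open>4^(-j)\<close>-separated in \<open>[0, 2^j]\<close>, so rounding \<open>4^j * l n\<close> down is injective.\<close>

lemma active_card: "finite (active j)" "card (active j) \<le> 8 ^ j + 1"
proof -
  define g where "g n = nat \<lfloor>4 ^ j * l n\<rfloor>" for n
  have inj: "inj_on g (active j)"
  proof (rule inj_onI, rule ccontr)
    fix n m assume nm: "n \<in> active j" "m \<in> active j" "g n = g m" "n \<noteq> m"
    have "\<lfloor>4 ^ j * l n\<rfloor> = \<lfloor>4 ^ j * l m\<rfloor>"
      using nm(3) nonneg by (simp add: g_def eq_nat_nat_iff)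
    hence "\<bar>4 ^ j * l n - 4 ^ j * l m\<bar> < 1" by linarith
    also have "\<bar>4 ^ j * l n - 4 ^ j * l m\<bar> = 4 ^ j * \<bar>l n - l m\<bar>"
      by (simp add: abs_mult flip: right_diff_distrib)
    finally show False using fine_gap[OF nm(1,4)] by simp
  qed
  have sub: "g ` active j \<subseteq> {..8 ^ j}"
  proof safe
    fix n assume "n \<in> active j"
    hence "4 ^ j * l n \<le> 4 ^ j * 2 ^ j" by (intro mult_left_mono) (auto simp: active_iff)
    also have "\<dots> = 8 ^ j" by (simp flip: power_mult_distrib)
    finally have "\<lfloor>4 ^ j * l n\<rfloor> \<le> \<lfloor>8 ^ j :: real\<rfloor>" by (rule floor_mono)
    also have "\<dots> = 8 ^ j" by (metis floor_of_int of_int_numeral of_int_power)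
    finally have "g n \<le> nat (8 ^ j)" unfolding g_def by (rule nat_mono)
    thus "g n \<le> 8 ^ j" by (simp add: nat_power_eq)
  qed
  show "finite (active j)" by (rule inj_on_finite[OF inj sub]) simp
  show "card (active j) \<le> 8 ^ j + 1" using card_inj_on_le[OF inj sub] by simp
qed

lemma V_ge_1: "1 \<le> j \<Longrightarrow> 1 \<le> V j"
  using \<epsilon> by (simp add: V_def ge_one_powr_ge_zero)

lemma V_pos: "1 \<le> j \<Longrightarrow> 0 < V j"
  using V_ge_1[of j] by simp

lemma V_mono: "1 \<le> i \<Longrightarrow> i \<le> j \<Longrightarrow> V i \<le> V j"
  using \<epsilon> by (auto simp: V_def intro!: powr_mono2)



lemma V_tail: "1 \<le> j \<Longrightarrow> V j * tail j = 1"
  by (simp add: V_def tail_def powr_minus)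

lemma weight_nonneg: "1 \<le> j \<Longrightarrow> 0 \<le> weight j"
  using \<epsilon> by (simp add: weight_def tail_def powr_mono2')

lemma weight_le: "1 \<le> j \<Longrightarrow> weight j \<le> \<epsilon> * real j powr (- 1 - \<epsilon>)"
proof -
  assume j: "1 \<le> j"
  have "\<exists>z>real j. z < real j + 1 \<and> (\<lambda>x. x powr (- \<epsilon>)) (real j + 1) - (\<lambda>x. x powr (- \<epsilon>)) (real j) = (real j + 1 - real j) * (- \<epsilon> * z powr (- \<epsilon> - 1))"
    using j by (intro MVT2) (auto intro!: derivative_eq_intros)
  then obtain z where z: "z > real j" "(real j + 1) powr (- \<epsilon>) - real j powr (- \<epsilon>) = - \<epsilon> * z powr (- \<epsilon> - 1)" by auto
  have "z powr (- \<epsilon> - 1) \<le> real j powr (- \<epsilon> - 1)" using z j \<epsilon> by (intro powr_mono2') auto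
  hence "\<epsilon> * z powr (- \<epsilon> - 1) \<le> \<epsilon> * real j powr (- \<epsilon> - 1)" using \<epsilon> by (intro mult_left_mono) auto
  moreover have "weight j = \<epsilon> * z powr (- \<epsilon> - 1)" using z(2) by (simp add: weight_def tail_def add.commute)
  moreover have "- \<epsilon> - 1 = - 1 - \<epsilon>" by simp
  ultimately show ?thesis by simp
qed

text \<open>Here the logarithmic loss in the separation is paid for: a factor \<open>j\<close> is absorbed by one weight, at the
  price of \<open>V j\<close>, with the small factor \<open>\<epsilon>\<close> left over.\<close>

lemma weight_V_le: "1 \<le> j \<Longrightarrow> weight j * real j * V j \<le> \<epsilon>"
proof -
  assume j: "1 \<le> j"
  have "weight j * real j * V j \<le> (\<epsilon> * real j powr (- 1 - \<epsilon>)) * real j * V j"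
    using weight_le[OF j] V_pos[OF j] by (intro mult_right_mono) auto
  also have "\<dots> = \<epsilon> * (real j powr (- 1 - \<epsilon>) * real j powr 1 * real j powr \<epsilon>)"
    using j by (simp add: V_def)
  also have "real j powr (- 1 - \<epsilon>) * real j powr 1 * real j powr \<epsilon> = 1"
  proof -
    have "real j powr (- 1 - \<epsilon>) * real j powr 1 * real j powr \<epsilon> = real j powr 0"
      by (simp only: powr_add[symmetric]) simp
    thus ?thesis using j by simp
  qed
  finally show ?thesis by simp
qed

text \<open>The exponent of the terms is \<open>- 1 - \<epsilon> / 2\<close>, so this is where \<open>\<epsilon> > 0\<close> enters.\<close>

lemma summable_weight_sqrt_V: "summable (\<lambda>j. weight j * sqrt (V j))"
proof (rule summable_comparison_test'[of "\<lambda>j. \<epsilon> * real j powr (- 1 - \<epsilon> / 2)" 1])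
  show "summable (\<lambda>j. \<epsilon> * real j powr (- 1 - \<epsilon> / 2))"
    using \<epsilon> by (intro summable_mult) (simp add: summable_real_powr_iff)
  fix j :: nat assume j: "1 \<le> j"
  have "weight j * sqrt (V j) \<le> (\<epsilon> * real j powr (- 1 - \<epsilon>)) * sqrt (V j)"
    using weight_le[OF j] V_pos[OF j] by (intro mult_right_mono) auto
  also have "\<epsilon> * real j powr (- 1 - \<epsilon>) * sqrt (V j) = \<epsilon> * real j powr (- 1 - \<epsilon> / 2)"
  proof -
    have "sqrt (V j) = real j powr (\<epsilon> / 2)"
      using j by (simp add: V_def powr_half_sqrt[symmetric] powr_powr)
    moreover
    have "real j powr (- 1 - \<epsilon>) * real j powr (\<epsilon> / 2) = real j powr (- 1 - \<epsilon> / 2)"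
      unfolding powr_add[symmetric] by (rule arg_cong[where f="\<lambda>u. real j powr u"]) simp
    ultimately show ?thesis by (simp only: mult.assoc)
  qed
  finally show "norm (weight j * sqrt (V j)) \<le> \<epsilon> * real j powr (- 1 - \<epsilon> / 2)"
    using weight_nonneg[OF j] V_pos[OF j] by simp
qed

lemma sum_weight: "m \<le> N \<Longrightarrow> (\<Sum>j\<in>{m..<N}. weight j) = tail m - tail N"
  by (induction rule: dec_induct) (auto simp: weight_def)

lemma tail_tendsto_0: "tail \<longlonglongrightarrow> 0"
  unfolding tail_def using \<epsilon> by (intro tendsto_neg_powr) (auto intro: filterlim_real_sequentially)

lemma energy_nonneg: "0 \<le> energy d j" by (simp add: energy_def sum_nonneg)

lemma coef_sq_le: "(\<Sum>n\<in>active j. (coef d n)\<^sup>2) \<le> energy d j"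
  unfolding energy_def
proof (rule sum_mono)
  fix n
  have "\<bar>coef d n\<bar> \<le> \<bar>V (level n) * d n\<bar>" by (simp add: coef_def)
  thus "(coef d n)\<^sup>2 \<le> (V (level n) * d n)\<^sup>2" by (simp only: abs_le_square_iff)
qed

lemma layer_self_dual: "has_cos_transform (layer d j) (layer d j)"
  unfolding layer_def[abs_def]
  by (intro has_cos_transform_sum has_cos_transform_scale packet_self_dual active_card) auto

lemma layer_split:
  "layer d j y = (\<Sum>n\<in>active j. coef d n * (bump (4 ^ j * (y - l n)) + bump (4 ^ j * (y + l n)))) + spill d j y"
proof -
  have "coef d n * packet (1 / 4 ^ j) (l n) y
      = coef d n * (bump (4 ^ j * (y - l n)) + bump (4 ^ j * (y + l n))) 
        + 2 / 4 ^ j * wave (y / 4 ^ j) * (coef d n * cos (2 * pi * l n * y))" for n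
    unfolding packet_def by (simp add: distrib_left mult_ac)
  thus ?thesis unfolding layer_def spill_def by (simp only: sum.distrib sum_distrib_left)
qed

text \<open>Bumps at different nodes do not meet, so the bump part of a layer reproduces the data, scaled by
  \<open>V (level m)\<close>, at the active nodes and vanishes at all others.\<close>

lemma layer_at_node:
  "layer d j (l m) = (if level m \<le> j then V (level m) * d m else 0) + spill d j (l m)"
proof -
  have off: "bump (4 ^ j * (l m - l n)) = 0 \<and> bump (4 ^ j * (l m + l n)) = 0" if "n \<in> active j" "n \<noteq> m" for n
  proof -
    have 1: "1 \<le> 4 ^ j * \<bar>l n - l m\<bar>" by (rule fine_gap[OF that])
    also have "\<dots> \<le> 4 ^ j * \<bar>l m + l n\<bar>" using nonneg[of n] nonneg[of m] by (intro mult_left_mono) auto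
    finally have 2: "1 \<le> 4 ^ j * \<bar>l m + l n\<bar>" .
    show ?thesis using 1 2 by (auto intro!: bump_zero simp: abs_mult abs_minus_commute)
  qed
  have on: "coef d m * (bump (4 ^ j * (l m - l m)) + bump (4 ^ j * (l m + l m))) = V (level m) * d m" if "m \<in> active j"
  proof (cases "l m = 0")
    case True
    then show ?thesis by (simp add: coef_def)
  next
    case False
    obtain n0 where n0: "l n0 = 0" using zero_node by blast
    have "1 \<le> 4 ^ j * \<bar>l m - l n0\<bar>" by (rule fine_gap) (use that n0 False in auto)
    also have "\<dots> \<le> 4 ^ j * \<bar>l m + l m\<bar>" using nonneg[of m] n0 by (intro mult_left_mono) auto
    finally have "bump (4 ^ j * (l m + l m)) = 0" by (intro bump_zero) (simp add: abs_mult)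
    thus ?thesis using False by (simp add: coef_def)
  qed
  have "(\<Sum>n\<in>active j. coef d n * (bump (4 ^ j * (l m - l n)) + bump (4 ^ j * (l m + l n))))
     = (\<Sum>n\<in>active j. if n = m then V (level m) * d m else 0)"
    using on off by (intro sum.cong refl) auto
  also have "\<dots> = (if level m \<le> j then V (level m) * d m else 0)"
    using active_card(1) by (simp add: active_def)
  finally show ?thesis by (simp add: layer_split)
qed

section \<open>The spill at the nodes and the size of the layers\<close>

text \<open>For \<open>i \<le> 2 * j\<close> the double zero of \<open>wave\<close> is used, for \<open>i > 2 * j\<close> its quadratic decay; in the
  latter case the node exceeds \<open>2^(i-1)\<close>, because \<open>i > j0\<close> and \<open>i\<close> is its level.\<close>

lemma wave_le_gap:
  assumes j: "j0 \<le> j" and m: "level m = i"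
  shows "wave (l m / 4 ^ j) \<le> 4 * (1 / 4) ^ scale_gap i j"
proof (cases "i \<le> 2 * j")
  case True
  define r where "r = 2 * j - i"
  have r: "scale_gap i j = r" "2 * j = i + r" using True by (auto simp: scale_gap_def r_def)
  have "(4::real) ^ j = 2 ^ (2 * j)" by (simp add: power_mult)
  hence p4: "(4::real) ^ j = 2 ^ i * 2 ^ r" by (simp only: r(2) power_add)
  have "l m / 4 ^ j \<le> 2 ^ i / 4 ^ j" using l_le_level[of m] m by (intro divide_right_mono) auto
  also have "\<dots> = (1 / 2) ^ r" unfolding p4 by (simp add: power_divide)
  finally have "(l m / 4 ^ j)\<^sup>2 \<le> ((1 / 2) ^ r)\<^sup>2" using nonneg by (intro power_mono) auto
  also have "\<dots> = (1 / 4) ^ r" by (simp add: power2_eq_square flip: power_mult_distrib)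
  finally have 1: "(l m / 4 ^ j)\<^sup>2 \<le> (1 / 4) ^ r" .
  have "(pi / 2)\<^sup>2 \<le> 2\<^sup>2" using pi_less_4 by (intro power_mono) auto
  hence "(pi / 2)\<^sup>2 * (l m / 4 ^ j)\<^sup>2 \<le> 4 * (1 / 4) ^ r" using 1 by (intro mult_mono) auto
  with wave_le_quadratic[of "l m / 4 ^ j"] show ?thesis unfolding r(1) by linarith
next
  case False
  define r where "r = i - 2 * j"
  have r: "scale_gap i j = r" "i = Suc (2 * j + r - 1)" "1 \<le> r" using False by (auto simp: scale_gap_def r_def)
  have "\<not> level m \<le> i - 1" using m False by auto
  hence "2 ^ (i - 1) < l m" using j False j0(1) unfolding level_le_iff by (auto simp: not_le)
  moreover have "(2::real) ^ (i - 1) = 4 ^ j * 2 ^ r / 2"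
  proof -
    have "(2::real) ^ Suc (i - 1) = 2 ^ (2 * j + r)" using r by (intro arg_cong[where f="\<lambda>k. 2 ^ k"]) auto
    thus ?thesis by (simp add: power_add power_mult)
  qed
  ultimately have lm: "4 ^ j * 2 ^ r / 2 < l m" by simp
  hence lo: "2 ^ r / 2 \<le> l m / 4 ^ j" by (simp add: field_simps)
  have pos: "0 < l m / 4 ^ j" by (rule less_le_trans[OF _ lo]) simp
  have "(2 ^ r / 2)\<^sup>2 \<le> (l m / 4 ^ j)\<^sup>2" using lo by (intro power_mono) auto
  moreover have "(2 ^ r / 2)\<^sup>2 = (4 ^ r / 4 :: real)"
    by (simp add: power2_eq_square flip: power_mult_distrib)
  ultimately have 1: "4 ^ r / 4 \<le> (l m / 4 ^ j)\<^sup>2" by simp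
  have "(2 / pi)\<^sup>2 \<le> 1\<^sup>2" using pi_ge_two by (intro power_mono) auto
  hence "(2 / pi)\<^sup>2 / (l m / 4 ^ j)\<^sup>2 \<le> 1 / (4 ^ r / 4)" using 1 by (intro frac_le) auto
  also have "\<dots> = 4 * (1 / 4) ^ r" by (simp add: power_divide)
  finally show ?thesis using wave_le_inverse[of "l m / 4 ^ j"] pos unfolding r(1) by linarith
qed

text \<open>The large sieve is applied with \<open>T\<close> comparable to \<open>2^X\<close>, \<open>X = max i (2 * j)\<close>, which covers the nodes of level \<open>i\<close> and is
  long enough for the frequencies of layer \<open>j\<close>, and with the window width \<open>h = c / (T * X)\<close>, below the gaps of
  these nodes.  The quotient \<open>T / h\<close> is at most \<open>72 * 16^j * 8^r * j / c\<close>, \<open>r = scale_gap i j\<close>, and the square of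
  the envelope gains \<open>16^(-j) * 16^(-r)\<close>; a decay in \<open>r\<close> remains.  The constant is \<open>64 * 16 * 72\<close>, with \<open>64\<close>
  from the envelope and \<open>16\<close> from the sieve.\<close>

lemma block_bound:
  assumes j: "j0 \<le> j" and fin: "finite M" and M: "\<And>m. m \<in> M \<Longrightarrow> level m = i"
  shows "(\<Sum>m\<in>M. (spill d j (l m))\<^sup>2) \<le> 73728 * real j / c * (1 / 2) ^ scale_gap i j * energy d j"
proof (cases "M = {}")
  case True
  thus ?thesis using energy_nonneg[of d j] c by simp
next
  case False
  have i: "1 \<le> i" using False M level_pos by blast
  have j1: "1 \<le> j" using j j0(1) by simp
  define r where "r = scale_gap i j"
  define X where "X = max i (2 * j)"
  define T :: real where "T = 6 * 2 ^ X"
  define h where "h = c / (T * real X)"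
  define S where "S y = (\<Sum>n\<in>active j. coef d n * cos (2 * pi * l n * y))" for y
  have X: "1 \<le> X" "i \<le> X" "2 * j \<le> X" "X \<le> 2 * j + r" 
    using j1 by (auto simp: X_def r_def scale_gap_def)
  have T: "T \<ge> 6" by (simp add: T_def)
  have h: "h > 0" "h \<le> 1" "h * T = c / real X"
  proof -
    show "h > 0" using c X T by (simp add: h_def)
    have "1 * 1 \<le> T * real X" using T X by (intro mult_mono) auto
    thus "h \<le> 1" using c X T by (simp add: h_def divide_le_eq)
    show "h * T = c / real X" using T X by (simp add: h_def)
  qed
  have hp: "2 ^ k * h \<le> 1 / 6" if "k \<le> X" for k
  proof -
    have "2 ^ k * h \<le> 2 ^ X * h" using that h(1) by (intro mult_right_mono power_increasing) auto
    also have "\<dots> = c / real X / 6"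
    proof -
      have "6 * (2 ^ X * h) = c / real X" using h(3) by (simp only: T_def mult_ac)
      thus ?thesis by simp
    qed
    also have "\<dots> \<le> 1 / 6" using c X by (simp add: field_simps)
    finally show ?thesis .
  qed
  have sieve: "(\<Sum>m\<in>M. (S (l m))\<^sup>2) \<le> 16 * T / h * (\<Sum>n\<in>active j. (coef d n)\<^sup>2)"
    unfolding S_def
  proof (rule large_sieve_cos[OF active_card(1) fin])
    show "T > 0" using T by simp
    show "h > 0" by (rule h)
    show "0 \<le> l n" for n by (rule nonneg)
    show "l n * h \<le> 1 / 3" if "n \<in> active j" for n
    proof -
      have "l n * h \<le> 2 ^ j * h" using that h(1) by (intro mult_right_mono) (auto simp: active_iff)
      thus ?thesis using hp[of j] X by simp
    qed
    show "1 \<le> T * \<bar>l n - l m\<bar>" if "n \<in> active j" "m \<in> active j" "n \<noteq> m" for n m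
    proof -
      have "1 \<le> 4 ^ j * \<bar>l n - l m\<bar>" by (rule fine_gap[OF that(1,3)])
      also have "\<dots> \<le> T * \<bar>l n - l m\<bar>"
      proof (rule mult_right_mono)
        have "(4::real) ^ j = 2 ^ (2 * j)" by (simp add: power_mult)
        also have "\<dots> \<le> 2 ^ X" using X by (intro power_increasing) auto
        also have "\<dots> \<le> T" by (simp add: T_def)
        finally show "4 ^ j \<le> T" .
      qed auto
      finally show ?thesis .
    qed
    show "\<bar>l m\<bar> + h / 2 \<le> T / 3" if "m \<in> M" for m
    proof -
      have "l m \<le> 2 ^ i" using l_le_level[of m] M[OF that] by simp
      also have "\<dots> \<le> 2 ^ X" using X by (intro power_increasing) auto
      finally have "\<bar>l m\<bar> \<le> 2 ^ X" using nonneg[of m] by simp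
      moreover have "(1::real) \<le> 2 ^ X" by simp
      ultimately show ?thesis using h(2) unfolding T_def by linarith
    qed
    show "h < \<bar>l m - l m'\<bar>" if "m \<in> M" "m' \<in> M" "m \<noteq> m'" for m m'
    proof -
      have "2 ^ i * real i \<le> 2 ^ X * real X" using X by (intro mult_mono power_increasing) auto
      moreover have "(0::real) < 2 ^ X * real X" using X by simp
      ultimately have "2 ^ i * real i < T * real X" by (simp add: T_def)
      hence "h < c / (2 ^ i * real i)" unfolding h_def using c i T X(1) by (intro divide_strict_left_mono mult_pos_pos) auto
      also have "\<dots> \<le> \<bar>l m - l m'\<bar>"
        using l_le_level[of m] l_le_level[of m'] M that i by (intro gap) auto
      finally show ?thesis .
    qed
  qed
  have Th: "T / h \<le> 72 * (16 ^ j * 8 ^ r * real j / c)"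
  proof -
    have "T / h = 36 * (4 ^ X * real X / c)"
      using T X c by (simp add: h_def T_def field_simps flip: power_mult_distrib)
    moreover have "(4::real) ^ X \<le> 16 ^ j * 4 ^ r"
    proof -
      have "(4::real) ^ X \<le> 4 ^ (2 * j + r)" using X by (intro power_increasing) auto
      thus ?thesis by (simp add: power_add power_mult)
    qed
    moreover have "real X \<le> 2 * real j * 2 ^ r"
    proof -
      have "real r < 2 ^ r" by (rule of_nat_less_two_power)
      hence r1: "1 + real r \<le> 2 ^ r" by (metis Suc_leI of_nat_Suc of_nat_le_iff of_nat_less_iff of_nat_numeral of_nat_power add.commute)
      have "real X \<le> 2 * real j + real r" using X(4) by linarith
      also have "\<dots> \<le> 2 * real j * (1 + real r)"
      proof -
        have "real r * 1 \<le> real r * (2 * real j)" using j1 by (intro mult_left_mono) auto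
        thus ?thesis by (simp add: algebra_simps)
      qed
      also have "\<dots> \<le> 2 * real j * 2 ^ r" using r1 by (intro mult_left_mono) auto
      finally show ?thesis .
    qed
    ultimately have "4 ^ X * real X \<le> (16 ^ j * 4 ^ r) * (2 * real j * 2 ^ r)"
      by (intro mult_mono) auto
    also have "\<dots> = 2 * (16 ^ j * 8 ^ r * real j)"
      using power_mult_distrib[of "4::real" 2 r] by simp
    finally have "4 ^ X * real X / c \<le> 2 * (16 ^ j * 8 ^ r * real j) / c"
      using c by (intro divide_right_mono) auto
    thus ?thesis using \<open>T / h = _\<close> by simp
  qed
  have "(\<Sum>m\<in>M. (spill d j (l m))\<^sup>2) \<le> (\<Sum>m\<in>M. (2 / 4 ^ j * (4 * (1 / 4) ^ r))\<^sup>2 * (S (l m))\<^sup>2)"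
  proof (rule sum_mono)
    fix m assume m: "m \<in> M"
    have "2 / 4 ^ j * wave (l m / 4 ^ j) \<le> 2 / 4 ^ j * (4 * (1 / 4) ^ r)"
      unfolding r_def by (intro mult_left_mono wave_le_gap j M m) auto
    hence "(2 / 4 ^ j * wave (l m / 4 ^ j))\<^sup>2 \<le> (2 / 4 ^ j * (4 * (1 / 4) ^ r))\<^sup>2"
      using wave_nonneg by (intro power_mono) auto
    hence "(2 / 4 ^ j * wave (l m / 4 ^ j))\<^sup>2 * (S (l m))\<^sup>2 \<le> (2 / 4 ^ j * (4 * (1 / 4) ^ r))\<^sup>2 * (S (l m))\<^sup>2"
      by (intro mult_right_mono) auto
    thus "(spill d j (l m))\<^sup>2 \<le> (2 / 4 ^ j * (4 * (1 / 4) ^ r))\<^sup>2 * (S (l m))\<^sup>2"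
      by (simp only: spill_def S_def power_mult_distrib[of _ "sum _ _"])
  qed
  also have "\<dots> = (2 / 4 ^ j * (4 * (1 / 4) ^ r))\<^sup>2 * (\<Sum>m\<in>M. (S (l m))\<^sup>2)"
    by (simp only: sum_distrib_left)
  also have "\<dots> \<le> (2 / 4 ^ j * (4 * (1 / 4) ^ r))\<^sup>2 * (16 * T / h * energy d j)"
  proof (intro mult_left_mono)
    have "16 * T / h * (\<Sum>n\<in>active j. (coef d n)\<^sup>2) \<le> 16 * T / h * energy d j"
      using T h(1) by (intro mult_left_mono coef_sq_le) auto
    with sieve show "(\<Sum>m\<in>M. (S (l m))\<^sup>2) \<le> 16 * T / h * energy d j" by linarith
  qed auto
  also have "\<dots> = (64 * 16 * energy d j) * ((1 / 16) ^ j * (1 / 16) ^ r) * (T / h)"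
  proof -
    have sq: "((1::real) / 4) ^ k * (1 / 4) ^ k = (1 / 16) ^ k" for k by (simp flip: power_mult_distrib)
    have "(2 / 4 ^ j * (4 * (1 / 4) ^ r))\<^sup>2 = 64 * (((1 / 4 :: real) ^ j * (1 / 4) ^ j) * ((1 / 4) ^ r * (1 / 4) ^ r))"
      by (simp add: power2_eq_square power_divide)
    thus ?thesis unfolding sq by simp
  qed
  also have "\<dots> \<le> (64 * 16 * energy d j) * ((1 / 16) ^ j * (1 / 16) ^ r) * (72 * (16 ^ j * 8 ^ r * real j / c))"
    using energy_nonneg by (intro mult_left_mono Th) auto
  also have "\<dots> = 73728 * real j / c * (((1 / 16) ^ j * 16 ^ j) * ((1 / 16) ^ r * 8 ^ r)) * energy d j"
    by simp
  also have "((1 / 16) ^ j * 16 ^ j) * ((1 / 16) ^ r * 8 ^ r) = ((1 / 2) ^ r :: real)"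
    by (simp flip: power_mult_distrib)
  finally show ?thesis by (simp only: r_def)
qed

text \<open>Since \<open>V\<close> grows more slowly than the identity, passing from scale \<open>j\<close> to level \<open>i\<close> costs less than the
  decay in \<open>scale_gap i j\<close> provides.\<close>

lemma V_le_gap:
  assumes "1 \<le> i" "1 \<le> j"
  shows "V i \<le> 2 * (3 / 2) ^ scale_gap i j * V j"
proof -
  define r where "r = scale_gap i j"
  have "i \<le> 2 * j + r" by (auto simp: r_def scale_gap_def)
  also have "\<dots> \<le> j * (2 + r)" using assms(2) by (cases j) auto
  finally have "real i \<le> real (j * (2 + r))" by (simp only: of_nat_le_iff)
  hence "V i \<le> (real j * (2 + real r)) powr \<epsilon>"
    unfolding V_def using \<epsilon> by (intro powr_mono2) (auto simp: algebra_simps)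
  also have "\<dots> = V j * (2 + real r) powr \<epsilon>" by (simp add: V_def powr_mult)
  also have "\<dots> \<le> V j * (2 + real r)"
  proof (intro mult_left_mono)
    show "(2 + real r) powr \<epsilon> \<le> 2 + real r" using \<epsilon> powr_mono[of \<epsilon> 1 "2 + real r"] by simp
  qed (use V_pos[OF assms(2)] in auto)
  also have "2 + real r \<le> 2 * (3 / 2) ^ r"
    using Bernoulli_inequality[of "1 / 2 :: real" r] by simp
  finally show ?thesis using V_pos[OF assms(2)] unfolding r_def
    by (simp add: mult.commute mult_left_mono)
qed

text \<open>The factor \<open>(10/9)^scale_gap\<close> is part of the decay from \<open>block_bound\<close>, set aside for the
  Cauchy-Schwarz inequality over the layers in \<open>residual_bound\<close>; \<open>3/2 * 10/9 * 1/2 = 5/6\<close> is still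
  below \<open>1\<close>.  The constant is \<open>24 * 73728\<close>, where \<open>24 = 2 * 2 / (1 - 5/6)\<close>.\<close>

lemma weighted_block_sum:
  assumes j: "j0 \<le> j" and fin: "finite M"
  shows "(\<Sum>m\<in>M. V (level m) * (10 / 9) ^ scale_gap (level m) j * (spill d j (l m))\<^sup>2)
           \<le> 1769472 / c * real j * V j * energy d j"
proof -
  define K where "K = 73728 * real j / c * energy d j"
  have j1: "1 \<le> j" using j j0(1) by simp
  have K: "0 \<le> K" using c energy_nonneg by (simp add: K_def)
  have "(\<Sum>m\<in>M. V (level m) * (10 / 9) ^ scale_gap (level m) j * (spill d j (l m))\<^sup>2)
     = (\<Sum>i\<in>level ` M. \<Sum>m\<in>{m\<in>M. level m = i}. V (level m) * (10 / 9) ^ scale_gap (level m) j * (spill d j (l m))\<^sup>2)"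
    using fin by (rule sum.image_gen)
  also have "\<dots> \<le> (\<Sum>i\<in>level ` M. 2 * V j * K * (5 / 6) ^ scale_gap i j)"
  proof (rule sum_mono)
    fix i assume "i \<in> level ` M"
    hence i: "1 \<le> i" using level_pos by auto
    have "(\<Sum>m\<in>{m\<in>M. level m = i}. V (level m) * (10 / 9) ^ scale_gap (level m) j * (spill d j (l m))\<^sup>2)
        = V i * (10 / 9) ^ scale_gap i j * (\<Sum>m\<in>{m\<in>M. level m = i}. (spill d j (l m))\<^sup>2)"
      by (simp add: sum_distrib_left)
    also have "\<dots> \<le> (2 * (3 / 2) ^ scale_gap i j * V j) * (10 / 9) ^ scale_gap i j * (K * (1 / 2) ^ scale_gap i j)"
    proof (intro mult_mono)
      show "V i \<le> 2 * (3 / 2) ^ scale_gap i j * V j" by (rule V_le_gap[OF i j1])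
      show "(\<Sum>m\<in>{m\<in>M. level m = i}. (spill d j (l m))\<^sup>2) \<le> K * (1 / 2) ^ scale_gap i j"
      proof -
        have "(\<Sum>m\<in>{m\<in>M. level m = i}. (spill d j (l m))\<^sup>2)
            \<le> 73728 * real j / c * (1 / 2) ^ scale_gap i j * energy d j"
          by (rule block_bound[OF j]) (use fin in auto)
        also have "\<dots> = K * (1 / 2) ^ scale_gap i j" by (simp add: K_def)
        finally show ?thesis .
      qed
    qed (use V_pos[OF j1] V_pos[OF i] in \<open>simp_all add: sum_nonneg\<close>)
    also have "\<dots> = 2 * V j * K * ((3 / 2) ^ scale_gap i j * (10 / 9) ^ scale_gap i j * (1 / 2) ^ scale_gap i j)"
      by (simp only: mult_ac)
    also have "(3 / 2) ^ scale_gap i j * (10 / 9) ^ scale_gap i j * (1 / 2) ^ scale_gap i j = (5 / 6 :: real) ^ scale_gap i j"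
      by (simp flip: power_mult_distrib)
    finally show "(\<Sum>m\<in>{m\<in>M. level m = i}. V (level m) * (10 / 9) ^ scale_gap (level m) j * (spill d j (l m))\<^sup>2)
      \<le> 2 * V j * K * (5 / 6) ^ scale_gap i j" .
  qed
  also have "\<dots> = 2 * V j * K * (\<Sum>i\<in>level ` M. (5 / 6) ^ scale_gap i j)"
    by (simp add: sum_distrib_left)
  also have "\<dots> \<le> 2 * V j * K * 12"
    using sum_scale_gap_le(2)[of "5 / 6" "level ` M" j] fin V_pos[OF j1] K by (intro mult_left_mono) auto
  finally show ?thesis by (simp add: K_def mult_ac)
qed

text \<open>After exchanging the sums, node \<open>n\<close> collects the weights from its level on; they telescope to
  \<open>tail (level n)\<close>, which cancels one of the two factors \<open>V (level n)\<close>.\<close>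

lemma sum_energy_le:
  assumes Q: "\<And>M. finite M \<Longrightarrow> (\<Sum>m\<in>M. V (level m) * (d m)\<^sup>2) \<le> Q"
  shows "(\<Sum>j\<in>{j0..<N}. weight j * energy d j) \<le> Q"
proof -
  have "(\<Sum>j\<in>{j0..<N}. weight j * energy d j) 
      = (\<Sum>j\<in>{j0..<N}. \<Sum>n\<in>active N. if level n \<le> j then weight j * (V (level n) * d n)\<^sup>2 else 0)"
  proof (rule sum.cong[OF refl])
    fix j assume j: "j \<in> {j0..<N}"
    have "active j = active N \<inter> {n. level n \<le> j}" using j by (auto simp: active_def)
    thus "weight j * energy d j = (\<Sum>n\<in>active N. if level n \<le> j then weight j * (V (level n) * d n)\<^sup>2 else 0)"
      by (simp add: energy_def sum_distrib_left sum.If_cases active_card)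
  qed
  also have "\<dots> = (\<Sum>n\<in>active N. \<Sum>j\<in>{j0..<N}. if level n \<le> j then weight j * (V (level n) * d n)\<^sup>2 else 0)"
    by (rule sum.swap)
  also have "\<dots> \<le> (\<Sum>n\<in>active N. V (level n) * (d n)\<^sup>2)"
  proof (rule sum_mono)
    fix n assume n: "n \<in> active N"
    have "{j0..<N} \<inter> {j. level n \<le> j} = {level n..<N}" using level_ge[of n] by auto
    hence "(\<Sum>j\<in>{j0..<N}. if level n \<le> j then weight j * (V (level n) * d n)\<^sup>2 else 0) = (\<Sum>j\<in>{level n..<N}. weight j) * (V (level n) * d n)\<^sup>2"
      by (simp add: sum.If_cases sum_distrib_right)
    also have "\<dots> \<le> tail (level n) * (V (level n) * d n)\<^sup>2"
      using sum_weight[of "level n" N] n by (intro mult_right_mono) (auto simp: active_def tail_def)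
    also have "\<dots> = (V (level n) * tail (level n)) * (V (level n) * (d n)\<^sup>2)"
      by (simp add: power2_eq_square)
    also have "\<dots> = V (level n) * (d n)\<^sup>2" using V_tail[OF level_pos] by simp
    finally show "(\<Sum>j\<in>{j0..<N}. if level n \<le> j then weight j * (V (level n) * d n)\<^sup>2 else 0) \<le> V (level n) * (d n)\<^sup>2" .
  qed
  also have "\<dots> \<le> Q" by (rule Q[OF active_card(1)])
  finally show ?thesis .
qed

text \<open>The total error at the nodes, truncated to finitely many layers so that all sums are finite.  The
  constant is \<open>20 * 1769472\<close>, where \<open>20 = 2 / (1 - 9/10)\<close>.\<close>

lemma residual_bound:
  assumes Q: "\<And>M. finite M \<Longrightarrow> (\<Sum>m\<in>M. V (level m) * (d m)\<^sup>2) \<le> Q" and fin: "finite M"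
  shows "(\<Sum>m\<in>M. V (level m) * (\<Sum>j\<in>{j0..<N}. weight j * spill d j (l m))\<^sup>2) \<le> 35389440 * \<epsilon> / c * Q"
proof -
  have cs: "(\<Sum>j\<in>{j0..<N}. weight j * spill d j (l m))\<^sup>2 
     \<le> 20 * (\<Sum>j\<in>{j0..<N}. (weight j)\<^sup>2 * ((10 / 9) ^ scale_gap (level m) j * (spill d j (l m))\<^sup>2))" for m
  proof -
    define g where "g j = scale_gap (level m) j" for j
    have "(\<Sum>j\<in>{j0..<N}. weight j * spill d j (l m))\<^sup>2 
       = (\<Sum>j\<in>{j0..<N}. sqrt ((9 / 10) ^ g j) * (sqrt ((10 / 9) ^ g j) * (weight j * spill d j (l m))))\<^sup>2"
    proof -
      have "sqrt ((9 / 10) ^ k) * sqrt ((10 / 9) ^ k) = 1" for k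
        by (simp flip: real_sqrt_mult power_mult_distrib)
      thus ?thesis by (simp flip: mult.assoc)
    qed
    also have "\<dots> \<le> (\<Sum>j\<in>{j0..<N}. (sqrt ((9 / 10) ^ g j))\<^sup>2) * (\<Sum>j\<in>{j0..<N}. (sqrt ((10 / 9) ^ g j) * (weight j * spill d j (l m)))\<^sup>2)"
      by (rule Cauchy_Schwarz_ineq_sum)
    also have "\<dots> = (\<Sum>j\<in>{j0..<N}. (9 / 10) ^ g j) * (\<Sum>j\<in>{j0..<N}. (weight j)\<^sup>2 * ((10 / 9) ^ g j * (spill d j (l m))\<^sup>2))"
      by (simp add: power_mult_distrib mult_ac)
    also have "\<dots> \<le> 20 * (\<Sum>j\<in>{j0..<N}. (weight j)\<^sup>2 * ((10 / 9) ^ g j * (spill d j (l m))\<^sup>2))"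
      using sum_scale_gap_le(1)[of "9 / 10" "{j0..<N}" "level m"]
      by (intro mult_right_mono sum_nonneg) (auto simp: g_def)
    finally show ?thesis by (simp only: g_def)
  qed
  have "(\<Sum>m\<in>M. V (level m) * (\<Sum>j\<in>{j0..<N}. weight j * spill d j (l m))\<^sup>2) 
     \<le> (\<Sum>m\<in>M. V (level m) * (20 * (\<Sum>j\<in>{j0..<N}. (weight j)\<^sup>2 * ((10 / 9) ^ scale_gap (level m) j * (spill d j (l m))\<^sup>2))))"
    using V_pos[OF level_pos] by (intro sum_mono mult_left_mono cs) (auto intro: less_imp_le)
  also have "\<dots> = (\<Sum>j\<in>{j0..<N}. 20 * (weight j)\<^sup>2 * (\<Sum>m\<in>M. V (level m) * (10 / 9) ^ scale_gap (level m) j * (spill d j (l m))\<^sup>2))"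
    unfolding sum_distrib_left by (subst sum.swap) (intro sum.cong refl, simp only: mult_ac)
  also have "\<dots> \<le> (\<Sum>j\<in>{j0..<N}. 20 * (weight j)\<^sup>2 * (1769472 / c * real j * V j * energy d j))"
    by (intro sum_mono mult_left_mono weighted_block_sum fin) auto
  also have "\<dots> \<le> (\<Sum>j\<in>{j0..<N}. 35389440 * \<epsilon> / c * (weight j * energy d j))"
  proof (rule sum_mono)
    fix j assume "j \<in> {j0..<N}"
    hence j: "1 \<le> j" using j0(1) by auto
    have "20 * (weight j)\<^sup>2 * (1769472 / c * real j * V j * energy d j) = 35389440 / c * (weight j * energy d j) * (weight j * real j * V j)"
      by (simp add: power2_eq_square)
    also have "\<dots> \<le> 35389440 / c * (weight j * energy d j) * \<epsilon>"
      using weight_nonneg[OF j] energy_nonneg c by (intro mult_left_mono weight_V_le[OF j]) auto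
    finally show "20 * (weight j)\<^sup>2 * (1769472 / c * real j * V j * energy d j) \<le> 35389440 * \<epsilon> / c * (weight j * energy d j)"
      by (simp add: mult_ac)
  qed
  also have "\<dots> = 35389440 * \<epsilon> / c * (\<Sum>j\<in>{j0..<N}. weight j * energy d j)" by (simp only: sum_distrib_left)
  also have "\<dots> \<le> 35389440 * \<epsilon> / c * Q" using \<epsilon> c by (intro mult_left_mono sum_energy_le Q) auto
  finally show ?thesis .
qed

text \<open>The bumps are short and few enough for a crude count.  The waves are cosine sums under the positive
  weight \<open>fejer (x / T)\<close> of mass \<open>T\<close>, so their \<open>L\<^sup>1\<close> norm reduces to the weighted mean square that
  quasi-orthogonality bounds.\<close>

lemma layer_L1_bound:
  assumes j: "j0 \<le> j" and q: "q > 0" and Q: "\<And>M. finite M \<Longrightarrow> (\<Sum>m\<in>M. V (level m) * (d m)\<^sup>2) \<le> q\<^sup>2"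
  shows "(LINT y|lborel. \<bar>layer d j y\<bar>) \<le> (4 * (LINT y|lborel. \<bar>bump y\<bar>) + 4) * sqrt (V j) * q"
proof -
  have j1: "1 \<le> j" using j j0(1) by simp
  note Vj = V_pos[OF j1]
  define B where "B = (LINT y|lborel. \<bar>bump y\<bar>)"
  define S where "S y = (\<Sum>n\<in>active j. coef d n * cos (2 * pi * l n * y))" for y
  define T :: real where "T = 2 * 4 ^ j"
  have T: "T > 0" by (simp add: T_def)
  have B: "0 \<le> B" by (simp add: B_def)
  have en: "energy d j \<le> V j * q\<^sup>2"
  proof -
    have "energy d j \<le> (\<Sum>n\<in>active j. V j * (V (level n) * (d n)\<^sup>2))"
      unfolding energy_def
    proof (rule sum_mono)
      fix n assume "n \<in> active j"
      hence "V (level n) \<le> V j" by (intro V_mono level_pos) (auto simp: active_def)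
      hence "V (level n) * (V (level n) * (d n)\<^sup>2) \<le> V j * (V (level n) * (d n)\<^sup>2)"
        using V_pos[OF level_pos[of n]] by (intro mult_right_mono) auto
      thus "(V (level n) * d n)\<^sup>2 \<le> V j * (V (level n) * (d n)\<^sup>2)" by (simp add: power2_eq_square mult_ac)
    qed
    also have "\<dots> \<le> V j * q\<^sup>2"
      unfolding sum_distrib_left[symmetric] using Vj by (intro mult_left_mono Q active_card) auto
    finally show ?thesis .
  qed
  have csq: "(\<Sum>n\<in>active j. (coef d n)\<^sup>2) \<le> V j * q\<^sup>2" using coef_sq_le en by (rule order_trans)
  have intb: "integrable lborel (\<lambda>y. bump (4 ^ j * (y - a)))" 
    and L1b: "(LINT y|lborel. \<bar>bump (4 ^ j * (y - a))\<bar>) = B / 4 ^ j" for a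
  proof -
    have b: "integrable lborel bump" using bump_cos_transform by (simp add: has_cos_transform_def)
    show "integrable lborel (\<lambda>y. bump (4 ^ j * (y - a)))"
      using lborel_integrable_real_affine[OF b, of "4 ^ j" "- (4 ^ j * a)"] by (simp add: algebra_simps)
    show "(LINT y|lborel. \<bar>bump (4 ^ j * (y - a))\<bar>) = B / 4 ^ j"
      unfolding B_def using lborel_integral_real_affine[of "4 ^ j" "\<lambda>y. \<bar>bump y\<bar>" "- (4 ^ j * a)"]
      by (simp add: algebra_simps)
  qed
  define P where "P y = (\<Sum>n\<in>active j. \<bar>coef d n\<bar> * (\<bar>bump (4 ^ j * (y - l n))\<bar> + \<bar>bump (4 ^ j * (y - (- l n)))\<bar>))" for y
  have hb: "has_bochner_integral lborel (\<lambda>y. \<bar>bump (4 ^ j * (y - a))\<bar>) (B / 4 ^ j)" for a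
    unfolding has_bochner_integral_iff using integrable_abs[OF intb] L1b by blast
  have hbP: "has_bochner_integral lborel P (\<Sum>n\<in>active j. \<bar>coef d n\<bar> * (B / 4 ^ j + B / 4 ^ j))"
    unfolding P_def[abs_def]
    by (intro has_bochner_integral_sum has_bochner_integral_mult_right has_bochner_integral_add hb)
  hence intP: "integrable lborel P" by (simp add: has_bochner_integral_iff)
  have "(LINT y|lborel. P y) = (\<Sum>n\<in>active j. \<bar>coef d n\<bar> * (B / 4 ^ j + B / 4 ^ j))"
    using hbP by (simp add: has_bochner_integral_iff)
  also have "\<dots> = 2 * B / 4 ^ j * (\<Sum>n\<in>active j. \<bar>coef d n\<bar>)"
    by (simp add: sum_distrib_left mult_ac)
  also have "(\<Sum>n\<in>active j. \<bar>coef d n\<bar>) \<le> 2 * 4 ^ j * (sqrt (V j) * q)"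
  proof (rule power2_le_imp_le)
    have "(\<Sum>n\<in>active j. \<bar>coef d n\<bar>)\<^sup>2 = (\<Sum>n\<in>active j. 1 * \<bar>coef d n\<bar>)\<^sup>2" by simp
    also have "\<dots> \<le> (\<Sum>n\<in>active j. 1\<^sup>2) * (\<Sum>n\<in>active j. \<bar>coef d n\<bar>\<^sup>2)" by (rule Cauchy_Schwarz_ineq_sum)
    also have "\<dots> \<le> (4 * 16 ^ j) * (V j * q\<^sup>2)"
    proof (intro mult_mono)
      have "real (card (active j)) \<le> real (8 ^ j + 1)" using active_card(2)[of j] by (simp only: of_nat_le_iff)
      also have "\<dots> = 8 ^ j + 1" by simp
      also have "\<dots> \<le> 4 * (16 ^ j :: real)"
      proof -
        have "(8::real) ^ j \<le> 16 ^ j" "(1::real) \<le> 16 ^ j" by (auto intro: power_mono)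
        thus ?thesis by linarith
      qed
      finally show "(\<Sum>n\<in>active j. (1::real)\<^sup>2) \<le> 4 * 16 ^ j" by simp
    qed (use csq in \<open>auto intro: sum_nonneg\<close>)
    also have "\<dots> = (2 * 4 ^ j * (sqrt (V j) * q))\<^sup>2"
      using Vj by (simp add: power_mult_distrib power2_eq_square[of "4 ^ j"] flip: power_mult_distrib[of _ _ j])
    finally show "(\<Sum>n\<in>active j. \<bar>coef d n\<bar>)\<^sup>2 \<le> (2 * 4 ^ j * (sqrt (V j) * q))\<^sup>2" .
  qed (use Vj q in auto)
  finally have Pb: "(LINT y|lborel. P y) \<le> 4 * B * (sqrt (V j) * q)"
    using B by (simp add: mult_left_mono divide_right_mono mult.assoc)
  \<comment> \<open>since \<open>\<eta>\<close> bounds the root mean square of \<open>S\<close>, the inequality \<open>\<bar>S\<bar> \<le> (\<eta> + S^2 / \<eta>) / 2\<close> serves as Cauchy-Schwarz\<close>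
  define \<eta> where "\<eta> = sqrt (V j) * q"
  have \<eta>: "\<eta> > 0" "\<eta>\<^sup>2 = V j * q\<^sup>2" using Vj q by (auto simp: \<eta>_def power_mult_distrib)
  define R where "R y = 2 / T * (\<eta> * fejer (y / T) + fejer (y / T) * (S y)\<^sup>2 / \<eta>)" for y
  have K: "has_cos_transform (\<lambda>x. fejer (x / T)) (\<lambda>x. T * triangle (T * x))"
    using has_cos_transform_dilate[OF fejer_cos_transform, of "1 / T"] T by (simp add: mult.commute)
  have intK: "integrable lborel (\<lambda>x. fejer (x / T))" using K by (simp add: has_cos_transform_def)
  have "(LINT x|lborel. fejer (x / T) * cos (2 * pi * 0 * x)) = T * triangle (T * 0)"
    using K unfolding has_cos_transform_def by blast
  hence LK: "(LINT x|lborel. fejer (x / T)) = T" by simp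
  have sep: "1 \<le> T * \<bar>l n - l m\<bar>" if "n \<in> active j" "m \<in> active j" "n \<noteq> m" for n m
    using fine_gap[OF that(1,3)] by (simp add: T_def)
  note qo = fejer_quasi_orthogonality[where l = l and b = "coef d" and A = "active j" and T = T, OF active_card(1) T nonneg sep, folded S_def]
  have intR: "integrable lborel R" unfolding R_def[abs_def] using qo(1) intK by auto
  have "(LINT y|lborel. R y) = 2 / T * (\<eta> * T + (LINT y|lborel. fejer (y / T) * (S y)\<^sup>2) / \<eta>)"
    unfolding R_def using qo(1) intK LK by simp
  also have "\<dots> \<le> 2 / T * (\<eta> * T + T * \<eta>\<^sup>2 / \<eta>)"
  proof -
    have "T * (\<Sum>n\<in>active j. (coef d n)\<^sup>2) \<le> T * \<eta>\<^sup>2" using csq T \<eta> by (intro mult_left_mono) auto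
    with qo(2) have "(LINT y|lborel. fejer (y / T) * (S y)\<^sup>2) \<le> T * \<eta>\<^sup>2" by linarith
    thus ?thesis using T \<eta> by (intro mult_left_mono add_left_mono divide_right_mono) auto
  qed
  also have "\<dots> = 4 * \<eta>" using T \<eta>(1) by (simp add: field_simps power2_eq_square)
  finally have Rb: "(LINT y|lborel. R y) \<le> 4 * \<eta>" .
  have Fle: "\<bar>layer d j y\<bar> \<le> P y + R y" for y
  proof -
    have "\<bar>\<Sum>n\<in>active j. coef d n * (bump (4 ^ j * (y - l n)) + bump (4 ^ j * (y + l n)))\<bar> \<le> P y"
      unfolding P_def
      by (rule order_trans[OF sum_abs]) (auto intro!: sum_mono mult_left_mono abs_triangle_ineq simp: abs_mult)
    moreover have "\<bar>spill d j y\<bar> \<le> R y"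
    proof -
      have "\<bar>spill d j y\<bar> = 4 / T * wave (y / 4 ^ j) * \<bar>S y\<bar>"
        using wave_nonneg by (simp add: spill_def S_def T_def abs_mult)
      also have "\<dots> \<le> 4 / T * fejer (y / T) * ((\<eta> + (S y)\<^sup>2 / \<eta>) / 2)"
      proof (intro mult_mono)
        show "wave (y / 4 ^ j) \<le> fejer (y / T)" using wave_le_fejer[of "y / 4 ^ j"] by (simp add: T_def mult.commute)
        have "0 \<le> (\<eta> - \<bar>S y\<bar>)\<^sup>2" by simp
        hence "\<bar>S y\<bar> * \<eta> * 2 \<le> \<eta>\<^sup>2 + (S y)\<^sup>2" by (simp add: power2_diff mult_ac)
        thus "\<bar>S y\<bar> \<le> (\<eta> + (S y)\<^sup>2 / \<eta>) / 2" using \<eta>(1) by (simp add: field_simps power2_eq_square)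
      qed (use T fejer_nonneg wave_nonneg in auto)
      also have "\<dots> = R y"
      proof -
        have "4 / T * a * ((b + u) / 2) = 2 / T * (b * a + a * u)" for a b u
          using T by (simp add: field_simps)
        from this[of "fejer (y / T)" \<eta> "(S y)\<^sup>2 / \<eta>"] show ?thesis by (simp only: R_def times_divide_eq_right)
      qed
      finally show ?thesis .
    qed
    ultimately show ?thesis unfolding layer_split by linarith
  qed
  have "(LINT y|lborel. \<bar>layer d j y\<bar>) \<le> (LINT y|lborel. P y + R y)"
    using layer_self_dual[of d j] intP intR Fle
    by (intro integral_mono) (auto simp: has_cos_transform_def)
  also have "\<dots> = (LINT y|lborel. P y) + (LINT y|lborel. R y)" using intP intR by simp
  also have "\<dots> \<le> 4 * B * (sqrt (V j) * q) + 4 * \<eta>" using Pb Rb by simp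
  finally show ?thesis unfolding \<eta>_def B_def by (simp add: algebra_simps)
qed

end

section \<open>Exact interpolation by iteration\<close>

text \<open>The premise \<open>step\<close> interpolates data up to an error of half their size.  Applied to the successive
  errors it gives functions whose sum interpolates the unit vector at \<open>k\<close> exactly, as the values at each
  node telescope.\<close>

lemma interpolation_by_iteration:
  fixes l :: "nat \<Rightarrow> real" and v :: "nat \<Rightarrow> real"
  assumes v: "\<And>m. 0 < v m" and C: "0 \<le> C"
    and step: "\<And>d q. 0 < q \<Longrightarrow> (\<And>M. finite M \<Longrightarrow> (\<Sum>m\<in>M. v m * (d m)\<^sup>2) \<le> q\<^sup>2) \<Longrightarrow>
       \<exists>f. has_cos_transform f f \<and> (LINT x|lborel. \<bar>f x\<bar>) \<le> C * q \<and>
           (\<forall>M. finite M \<longrightarrow> (\<Sum>m\<in>M. v m * (d m - f (l m))\<^sup>2) \<le> (q / 2)\<^sup>2)"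
  shows "\<exists>f. has_cos_transform f f \<and> (\<forall>m. f (l m) = (if m = k then 1 else 0))"
proof -
  define nrm where "nrm d q \<longleftrightarrow> (\<forall>M. finite M \<longrightarrow> (\<Sum>m\<in>M. v m * (d m)\<^sup>2) \<le> q\<^sup>2)" for d :: "nat \<Rightarrow> real" and q :: real
  have "\<forall>d q. \<exists>f. 0 < q \<and> nrm d q \<longrightarrow> has_cos_transform f f \<and> (LINT x|lborel. \<bar>f x\<bar>) \<le> C * q \<and>
           nrm (\<lambda>m. d m - f (l m)) (q / 2)"
    using step unfolding nrm_def by meson
  then obtain G where G: "\<And>d q. 0 < q \<Longrightarrow> nrm d q \<Longrightarrow> has_cos_transform (G d q) (G d q) \<and> 
       (LINT x|lborel. \<bar>G d q x\<bar>) \<le> C * q \<and> nrm (\<lambda>m. d m - G d q (l m)) (q / 2)"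
    by metis
  define q where "q i = sqrt (v k) / 2 ^ i" for i :: nat
  have q: "0 < q i" "q (Suc i) = q i / 2" for i using v[of k] by (auto simp: q_def)
  define D where "D = rec_nat (\<lambda>m. if m = k then 1 else 0) (\<lambda>i d m. d m - G d (q i) (l m))"
  have D0: "D 0 = (\<lambda>m. if m = k then 1 else 0)" and DS: "D (Suc i) = (\<lambda>m. D i m - G (D i) (q i) (l m))" for i
    by (auto simp: D_def)
  have nD: "nrm (D i) (q i)" for i
  proof (induction i)
    case 0
    have "(\<Sum>m\<in>M. v m * (D 0 m)\<^sup>2) \<le> (q 0)\<^sup>2" if "finite M" for M
    proof -
      have "(\<Sum>m\<in>M. v m * (D 0 m)\<^sup>2) = (\<Sum>m\<in>M. if m = k then v k else 0)"
        by (intro sum.cong) (auto simp: D0)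
      also have "\<dots> \<le> v k" using that v[of k] by simp
      finally show ?thesis using v[of k] by (simp add: q_def)
    qed
    thus ?case by (simp add: nrm_def)
  next
    case (Suc i)
    show ?case using G[OF q(1) Suc] by (simp add: DS q(2))
  qed
  define f where "f i = G (D i) (q i)" for i
  have f: "has_cos_transform (f i) (f i)" "(LINT x|lborel. \<bar>f i x\<bar>) \<le> C * q i" for i
    using G[OF q(1) nD] by (auto simp: f_def)
  have "summable (\<lambda>i. C * (sqrt (v k) * (1 / 2) ^ i))"
    by (intro summable_mult summable_geometric) auto
  hence "summable (\<lambda>i. C * q i)" by (simp add: q_def power_divide)
  hence sm: "summable (\<lambda>i. LINT x|lborel. \<bar>f i x\<bar>)"
    by (rule summable_comparison_test') (use f(2) in auto)
  have "(\<Sum>i. f i (l m)) = (if m = k then 1 else 0)" for m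
  proof -
    have part: "(\<Sum>i<n. f i (l m)) = D 0 m - D n m" for n
      by (induction n) (auto simp: DS f_def)
    have "(\<lambda>n. D n m) \<longlonglongrightarrow> 0"
    proof (rule Lim_null_comparison)
      show "eventually (\<lambda>n. norm (D n m) \<le> (sqrt (v k) / sqrt (v m)) * (1 / 2) ^ n) sequentially"
      proof (intro always_eventually allI)
        fix n
        have "(\<Sum>m\<in>{m}. v m * (D n m)\<^sup>2) \<le> (q n)\<^sup>2" using nD unfolding nrm_def by blast
        hence "(sqrt (v m) * \<bar>D n m\<bar>)\<^sup>2 \<le> (q n)\<^sup>2" using v[of m] by (simp add: power_mult_distrib)
        hence "sqrt (v m) * \<bar>D n m\<bar> \<le> q n"
          by (rule power2_le_imp_le) (use q(1)[of n] in simp)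
        thus "norm (D n m) \<le> (sqrt (v k) / sqrt (v m)) * (1 / 2) ^ n"
          using v[of m] by (simp add: q_def field_simps)
      qed
      show "(\<lambda>n. (sqrt (v k) / sqrt (v m)) * (1 / 2) ^ n) \<longlonglongrightarrow> 0"
        by (intro tendsto_mult_right_zero LIMSEQ_power_zero) auto
    qed
    hence "(\<lambda>n. D 0 m - D n m) \<longlonglongrightarrow> D 0 m - 0" by (intro tendsto_intros)
    hence "(\<lambda>i. f i (l m)) sums D 0 m" unfolding sums_def part by simp
    thus ?thesis by (simp add: sums_iff D0)
  qed
  thus ?thesis using self_dual_series(1)[OF f(1) sm] by blast
qed

context separated_nodes
begin

text \<open>At a node the weighted layers sum to the datum, because the weights telescope to \<open>tail (level m)\<close>
  and \<open>V * tail = 1\<close>, plus the total spill.\<close>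

lemma approximate_interpolation:
  assumes small: "35389440 * \<epsilon> / c \<le> 1 / 4"
  defines "C \<equiv> (4 * (LINT y|lborel. \<bar>bump y\<bar>) + 4) * (\<Sum>j. weight (j + j0) * sqrt (V (j + j0)))"
  assumes q: "q > 0" and Q: "\<And>M. finite M \<Longrightarrow> (\<Sum>m\<in>M. V (level m) * (d m)\<^sup>2) \<le> q\<^sup>2"
  shows "\<exists>f. has_cos_transform f f \<and> (LINT x|lborel. \<bar>f x\<bar>) \<le> C * q \<and>
           (\<forall>M. finite M \<longrightarrow> (\<Sum>m\<in>M. V (level m) * (d m - f (l m))\<^sup>2) \<le> (q / 2)\<^sup>2)"
proof -
  define f where "f j x = weight (j + j0) * layer d (j + j0) x" for j x
  define B where "B = 4 * (LINT y|lborel. \<bar>bump y\<bar>) + 4"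
  have w_pos: "0 \<le> weight (j + j0)" for j using weight_nonneg[of "j + j0"] j0(1) by simp
  have sd: "has_cos_transform (f j) (f j)" for j
    unfolding f_def[abs_def] by (intro has_cos_transform_scale layer_self_dual)
  have L1: "(LINT x|lborel. \<bar>f j x\<bar>) \<le> B * q * (weight (j + j0) * sqrt (V (j + j0)))" for j
  proof -
    have "(LINT x|lborel. \<bar>f j x\<bar>) = weight (j + j0) * (LINT x|lborel. \<bar>layer d (j + j0) x\<bar>)"
      using w_pos by (simp add: f_def abs_mult)
    also have "\<dots> \<le> weight (j + j0) * (B * sqrt (V (j + j0)) * q)"
      unfolding B_def using w_pos q Q by (intro mult_left_mono layer_L1_bound) auto
    finally show ?thesis by (simp add: mult_ac)
  qed
  have sB: "summable (\<lambda>j. B * q * (weight (j + j0) * sqrt (V (j + j0))))"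
    by (intro summable_mult summable_ignore_initial_segment summable_weight_sqrt_V)
  have sm: "summable (\<lambda>j. LINT x|lborel. \<bar>f j x\<bar>)"
    by (rule summable_comparison_test'[OF sB, of 0]) (use L1 in auto)
  note series = self_dual_series[of f, OF sd sm]
  define g where "g x = (\<Sum>j. f j x)" for x
  have "(LINT x|lborel. \<bar>g x\<bar>) \<le> (\<Sum>j. LINT x|lborel. \<bar>f j x\<bar>)"
    unfolding g_def by (rule series(2))
  also have "\<dots> \<le> (\<Sum>j. B * q * (weight (j + j0) * sqrt (V (j + j0))))" by (rule suminf_le[OF L1 sm sB])
  also have "\<dots> = C * q"
    by (subst suminf_mult) (auto intro!: summable_ignore_initial_segment summable_weight_sqrt_V simp: C_def B_def)
  finally have gL1: "(LINT x|lborel. \<bar>g x\<bar>) \<le> C * q" .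
  have lim: "(\<lambda>N. \<Sum>j\<in>{j0..<N + j0}. weight j * spill d j (l m)) \<longlonglongrightarrow> g (l m) - d m" for m
  proof -
    have "(\<lambda>N. \<Sum>j<N. f j (l m)) \<longlonglongrightarrow> g (l m)"
      unfolding g_def by (rule summable_LIMSEQ[OF summable_rabs_cancel[OF series(3)]])
    moreover have "(\<lambda>N. (tail (level m) - tail (N + j0)) * (V (level m) * d m)) \<longlonglongrightarrow> (tail (level m) - 0) * (V (level m) * d m)"
      by (intro tendsto_intros LIMSEQ_ignore_initial_segment tail_tendsto_0)
    ultimately have lim: "(\<lambda>N. (\<Sum>j<N. f j (l m)) - (tail (level m) - tail (N + j0)) * (V (level m) * d m)) 
         \<longlonglongrightarrow> g (l m) - (tail (level m) - 0) * (V (level m) * d m)"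
      by (rule tendsto_diff)
    have eq: "(tail (level m) - 0) * (V (level m) * d m) = d m"
      using V_tail[OF level_pos[of m]] by (simp add: mult.assoc[symmetric] mult.commute[of "tail _"])
    have ev: "eventually (\<lambda>N. (\<Sum>j<N. f j (l m)) - (tail (level m) - tail (N + j0)) * (V (level m) * d m) 
         = (\<Sum>j\<in>{j0..<N + j0}. weight j * spill d j (l m))) sequentially"
      using eventually_ge_at_top[of "level m"]
    proof eventually_elim
      case (elim N)
      have "(\<Sum>j<N. f j (l m)) = (\<Sum>j\<in>{j0..<N + j0}. weight j * layer d j (l m))"
        unfolding f_def using sum.shift_bounds_nat_ivl[of "\<lambda>j. weight j * layer d j (l m)" 0 j0 N]
        by (simp add: atLeast0LessThan)
      also have "\<dots> = (\<Sum>j\<in>{j0..<N + j0}. if level m \<le> j then weight j * (V (level m) * d m) else 0) + (\<Sum>j\<in>{j0..<N + j0}. weight j * spill d j (l m))"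
        unfolding sum.distrib[symmetric] by (intro sum.cong refl) (auto simp: layer_at_node distrib_left)
      also have "(\<Sum>j\<in>{j0..<N + j0}. if level m \<le> j then weight j * (V (level m) * d m) else 0) = (\<Sum>j\<in>{level m..<N + j0}. weight j) * (V (level m) * d m)"
      proof -
        have "{j0..<N + j0} \<inter> {j. level m \<le> j} = {level m..<N + j0}" using level_ge[of m] by auto
        thus ?thesis by (simp add: sum.If_cases sum_distrib_right)
      qed
      also have "(\<Sum>j\<in>{level m..<N + j0}. weight j) = tail (level m) - tail (N + j0)" using elim by (intro sum_weight) auto
      finally show ?case by simp
    qed
    show ?thesis using Lim_transform_eventually[OF lim ev] unfolding eq .
  qed
  have "(\<Sum>m\<in>M. V (level m) * (d m - g (l m))\<^sup>2) \<le> (q / 2)\<^sup>2" if M: "finite M" for M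
  proof -
    have "(\<lambda>N. \<Sum>m\<in>M. V (level m) * (\<Sum>j\<in>{j0..<N + j0}. weight j * spill d j (l m))\<^sup>2) \<longlonglongrightarrow> (\<Sum>m\<in>M. V (level m) * (g (l m) - d m)\<^sup>2)"
      by (intro tendsto_intros lim)
    hence "(\<Sum>m\<in>M. V (level m) * (g (l m) - d m)\<^sup>2) \<le> 35389440 * \<epsilon> / c * q\<^sup>2"
      by (rule LIMSEQ_le_const2) (use residual_bound[OF Q M] in auto)
    also have "\<dots> \<le> 1 / 4 * q\<^sup>2" using small by (intro mult_right_mono) auto
    finally show ?thesis by (simp add: power2_commute power_divide)
  qed
  thus ?thesis using series(1) gL1 by (auto simp: g_def[abs_def])
qed

lemma self_dual_interpolation:
  assumes small: "35389440 * \<epsilon> / c \<le> 1 / 4"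
  shows "\<exists>f. has_cos_transform f f \<and> (\<forall>m. f (l m) = (if m = k then 1 else 0))"
proof (rule interpolation_by_iteration)
  show "0 < V (level m)" for m by (rule V_pos[OF level_pos])
  show "0 \<le> (4 * (LINT y|lborel. \<bar>bump y\<bar>) + 4) * (\<Sum>j. weight (j + j0) * sqrt (V (j + j0)))"
    using j0(1) weight_nonneg V_pos
    by (intro mult_nonneg_nonneg suminf_nonneg summable_ignore_initial_segment summable_weight_sqrt_V) (auto intro: less_imp_le)
qed (rule approximate_interpolation[OF small])

end

text \<open>Only the separation of the nodes enters: first \<open>j0\<close> is chosen large and then \<open>\<epsilon>\<close> small in terms
  of \<open>c\<close>.\<close>

theorem separated_nodes_interpolation:
  fixes l :: "nat \<Rightarrow> real"
  assumes nonneg: "\<And>n. 0 \<le> l n" and zero: "\<exists>n. l n = 0"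
    and c: "0 < c" 
    and gap: "\<And>n m i. n \<noteq> m \<Longrightarrow> l n \<le> 2 ^ i \<Longrightarrow> l m \<le> 2 ^ i \<Longrightarrow> 1 \<le> i \<Longrightarrow> c / (2 ^ i * real i) \<le> \<bar>l n - l m\<bar>"
  shows "\<exists>f. has_cos_transform f f \<and> (\<forall>m. f (l m) = (if m = k then 1 else 0))"
proof -
  \<comment> \<open>the estimates of \<open>block_bound\<close> need window widths of at most \<open>1\<close>\<close>
  define c' where "c' = min c 1"
  have c': "0 < c'" "c' \<le> 1" "c' \<le> c" using c by (auto simp: c'_def)
  have "((\<lambda>j::nat. 2 ^ (j + 1) * real (j + 1) / 4 ^ j) \<longlongrightarrow> 0) sequentially" by real_asymp
  hence "eventually (\<lambda>j::nat. 2 ^ (j + 1) * real (j + 1) / 4 ^ j < c') sequentially"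
    using c'(1) by (rule order_tendstoD)
  then obtain N where N: "\<And>j. N \<le> j \<Longrightarrow> 2 ^ (j + 1) * real (j + 1) / 4 ^ j < c'"
    by (auto simp: eventually_sequentially)
  define \<epsilon> where "\<epsilon> = c' / (4 * 35389440)"
  interpret separated_nodes l c' "max N 1" \<epsilon>
  proof
    show "c' / (2 ^ i * real i) \<le> \<bar>l n - l m\<bar>" if "n \<noteq> m" "l n \<le> 2 ^ i" "l m \<le> 2 ^ i" "1 \<le> i" for n m i
    proof -
      have "c' / (2 ^ i * real i) \<le> c / (2 ^ i * real i)" using c' by (intro divide_right_mono) auto
      with gap[OF that] show ?thesis by linarith
    qed
    show "2 ^ (j + 1) * real (j + 1) \<le> c' * 4 ^ j" if "max N 1 \<le> j" for j
      using N[of j] that by (simp add: divide_less_eq del: of_nat_Suc power_Suc of_nat_add)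
  qed (use nonneg zero c' in \<open>auto simp: \<epsilon>_def\<close>)
  show ?thesis by (rule self_dual_interpolation) (use c' in \<open>simp add: \<epsilon>_def\<close>)
qed

section \<open>The separation of the logarithmically dense nodes\<close>

definition log_shift :: "real \<Rightarrow> real" where "log_shift x = ln (exp 1 + x)"

text \<open>The correction \<open>x / (exp 1 + x)\<close> is what makes \<open>x / ((exp 1 + x) * log_shift x) \<le> 1 / 2\<close>, so that the logarithm in
  the denominator of the nodes removes at most half of the increment of the numerator.\<close>

lemma log_shift_lower: "0 \<le> x \<Longrightarrow> 1 + x / (exp 1 + x) \<le> log_shift x"
proof -
  assume x: "0 \<le> x"
  have e: "0 < (exp 1 :: real)" by simp
  have ex: "exp 1 + x > 0" using x e by linarith
  have "ln (exp 1 / (exp 1 + x)) \<le> exp 1 / (exp 1 + x) - 1"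
    using x e by (intro ln_le_minus_one divide_pos_pos add_pos_nonneg)
  moreover have "ln (exp 1 / (exp 1 + x)) = 1 - log_shift x"
    using ex unfolding log_shift_def by (subst ln_div) auto
  moreover have "exp 1 / (exp 1 + x) - 1 = - (x / (exp 1 + x))"
    using ex by (simp add: field_simps)
  ultimately show ?thesis by linarith
qed

lemma log_shift_ge_1: "0 \<le> x \<Longrightarrow> 1 \<le> log_shift x"
proof -
  assume x: "0 \<le> x"
  have "0 \<le> x / (exp 1 + x)" using x by (intro divide_nonneg_nonneg add_nonneg_nonneg) auto
  with log_shift_lower[OF x] show ?thesis by linarith
qed

lemma log_shift_step: "0 \<le> x \<Longrightarrow> log_shift (x + 1) \<le> log_shift x + 1 / (exp 1 + x)"
proof -
  assume x: "0 \<le> x"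
  have e: "0 < exp 1 + x" using x by (simp add: add_pos_nonneg)
  have "log_shift (x + 1) - log_shift x = ln ((exp 1 + x + 1) / (exp 1 + x))"
    using e unfolding log_shift_def by (subst ln_div) (auto simp: add.assoc)
  also have "\<dots> \<le> (exp 1 + x + 1) / (exp 1 + x) - 1"
    using e by (intro ln_le_minus_one) auto
  also have "\<dots> = 1 / (exp 1 + x)" using e by (simp add: field_simps)
  finally show ?thesis by simp
qed

lemma lambda_node_nonneg: "0 \<le> lambda_node \<beta> n"
  by (simp add: lambda_node_def)

lemma lambda_node_0: "lambda_node \<beta> 0 = 0"
  by (simp add: lambda_node_def)

lemma lambda_node_square: "(lambda_node \<beta> n)\<^sup>2 = real n / log_shift (real n) powr (2 * \<beta>)"
proof -
  have "(log_shift (real n) powr \<beta>)\<^sup>2 = log_shift (real n) powr (2 * \<beta>)"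
    by (simp add: power2_eq_square flip: powr_add)
  thus ?thesis by (simp add: lambda_node_def power_divide log_shift_def)
qed

context
  fixes \<beta> :: real
  assumes \<beta>: "0 \<le> \<beta>" "\<beta> \<le> 1 / 2"
begin

lemma log_powr_bounds:
  assumes "1 \<le> L" shows "1 \<le> L powr (2 * \<beta>)" "L powr (2 * \<beta>) \<le> L"
  using assms \<beta> powr_mono[of "2 * \<beta>" 1 L] by (auto simp: ge_one_powr_ge_zero)

text \<open>From \<open>k\<close> to \<open>k + 1\<close> the logarithm grows at most by a factor \<open>1 + y\<close>, where \<open>y\<close> is so small that \<open>k * y \<le> 1 / 2\<close>.  As
  \<open>2 * \<beta> \<le> 1\<close>, its power in the denominator of the squared node grows by no larger factor, and so at least
  half of the increment \<open>1\<close> of the numerator survives.\<close>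

lemma lambda_node_square_step:
  "1 / (2 * log_shift (real (Suc k))) \<le> (lambda_node \<beta> (Suc k))\<^sup>2 - (lambda_node \<beta> k)\<^sup>2"
proof -
  define x where "x = real k"
  define L where "L = log_shift x"
  define L' where "L' = log_shift (x + 1)"
  define y where "y = 1 / ((exp 1 + x) * L)"
  have x: "0 \<le> x" "0 < exp 1 + x" by (auto simp: x_def add_pos_nonneg)
  have L: "1 \<le> L" "1 \<le> L'" using log_shift_ge_1 x by (auto simp: L_def L'_def)
  have y: "0 < y" using x L by (simp add: y_def)
  have xy: "x * y \<le> 1 / 2"
  proof -
    have "(exp 1 + x) * (1 + x / (exp 1 + x)) \<le> (exp 1 + x) * L"
      using x log_shift_lower[of x] by (intro mult_left_mono) (auto simp: L_def)
    moreover have "(exp 1 + x) * (1 + x / (exp 1 + x)) = exp 1 + 2 * x"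
      using x by (simp add: field_simps)
    ultimately have "2 * x \<le> (exp 1 + x) * L" using exp_gt_zero[of "1::real"] by linarith
    moreover have "0 < (exp 1 + x) * L" using x L by (intro mult_pos_pos) auto
    ultimately have "x / ((exp 1 + x) * L) \<le> 1 / 2" by (subst pos_divide_le_eq) auto
    thus ?thesis by (simp add: y_def)
  qed
  have "L' \<le> L * (1 + y)"
  proof -
    have "L * y = 1 / (exp 1 + x)" using L x by (simp add: y_def)
    thus ?thesis using log_shift_step[OF x(1)] by (simp add: L_def L'_def distrib_left)
  qed
  hence "L' powr (2 * \<beta>) \<le> (L * (1 + y)) powr (2 * \<beta>)" using L \<beta> by (intro powr_mono2) auto
  also have "\<dots> = L powr (2 * \<beta>) * (1 + y) powr (2 * \<beta>)" using L y by (simp add: powr_mult)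
  also have "\<dots> \<le> L powr (2 * \<beta>) * (1 + y)" using log_powr_bounds[of "1 + y"] y by (intro mult_left_mono) auto
  finally have step: "L' powr (2 * \<beta>) \<le> L powr (2 * \<beta>) * (1 + y)" .
  note A = log_powr_bounds[OF L(1)] and B = log_powr_bounds[OF L(2)]
  have "x / L powr (2 * \<beta>) \<le> x * (1 + y) / L' powr (2 * \<beta>)"
  proof -
    have "0 < L powr (2 * \<beta>)" "0 < L' powr (2 * \<beta>)" using A(1) B(1) by linarith+
    thus ?thesis using mult_left_mono[OF step x(1)]
      by (simp add: pos_divide_le_eq pos_le_divide_eq mult_ac)
  qed
  moreover have "1 / (2 * L') \<le> (x + 1) / L' powr (2 * \<beta>) - x * (1 + y) / L' powr (2 * \<beta>)"
  proof -
    have "1 / (2 * L') \<le> (1 / 2) / L' powr (2 * \<beta>)" using B L by (simp add: frac_le)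
    also have "\<dots> \<le> (1 - x * y) / L' powr (2 * \<beta>)" using B xy by (intro divide_right_mono) auto
    also have "\<dots> = (x + 1) / L' powr (2 * \<beta>) - x * (1 + y) / L' powr (2 * \<beta>)"
      by (simp add: algebra_simps flip: diff_divide_distrib add_divide_distrib)
    finally show ?thesis .
  qed
  ultimately have "1 / (2 * L') \<le> (x + 1) / L' powr (2 * \<beta>) - x / L powr (2 * \<beta>)" by linarith
  thus ?thesis unfolding lambda_node_square by (simp add: x_def L_def L'_def add.commute)
qed

lemma lambda_node_mono: "n \<le> m \<Longrightarrow> lambda_node \<beta> n \<le> lambda_node \<beta> m"
proof (induction rule: dec_induct)
  case (step m)
  have "0 < 1 / (2 * log_shift (real (Suc m)))" using log_shift_ge_1[of "real (Suc m)"] by simp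
  hence "(lambda_node \<beta> m)\<^sup>2 \<le> (lambda_node \<beta> (Suc m))\<^sup>2" using lambda_node_square_step[of m] by linarith
  hence "lambda_node \<beta> m \<le> lambda_node \<beta> (Suc m)" by (rule power2_le_imp_le) (rule lambda_node_nonneg)
  thus ?case using step by linarith
qed auto

text \<open>A node below \<open>2^i\<close> has an index of at most \<open>4^i\<close> times a logarithm, so the logarithm of the index is \<open>O(i)\<close>.\<close>

lemma log_shift_le_level:
  assumes i: "1 \<le> i" and m: "lambda_node \<beta> m \<le> 2 ^ i"
  shows "log_shift (real m) \<le> 8 * real i"
proof -
  define L where "L = log_shift (real m)"
  have L: "1 \<le> L" using log_shift_ge_1 by (simp add: L_def)
  note B = log_powr_bounds[OF L]
  have "(lambda_node \<beta> m)\<^sup>2 \<le> (2 ^ i)\<^sup>2" using m lambda_node_nonneg by (intro power_mono) auto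
  also have "(2 ^ i)\<^sup>2 = (4 ^ i :: real)" by (simp add: power2_eq_square flip: power_mult_distrib)
  finally have "real m \<le> 4 ^ i * L powr (2 * \<beta>)"
    using B(1) unfolding lambda_node_square L_def[symmetric] by (subst (asm) pos_divide_le_eq) auto
  also have "\<dots> \<le> 4 ^ i * L" using B(2) by (intro mult_left_mono) auto
  finally have mL: "real m \<le> 4 ^ i * L" .
  have "1 * 1 \<le> 4 ^ i * L" using L by (intro mult_mono) auto
  hence "exp 1 + real m \<le> 4 ^ (i + 1) * L" using mL exp_le by simp
  hence "L \<le> ln (4 ^ (i + 1) * L)"
    unfolding L_def log_shift_def by (intro ln_mono) (auto simp: add_pos_nonneg)
  also have "\<dots> = ln (4 ^ (i + 1)) + ln L" using L by (subst ln_mult) auto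
  also have "ln ((4::real) ^ (i + 1)) = real (i + 1) * ln 4" by (rule ln_realpow)
  also have "real (i + 1) * ln 4 + ln L \<le> real (i + 1) * 2 + L / 2"
  proof (intro add_mono mult_left_mono)

    have l2: "ln (2::real) \<le> 1" using ln_le_minus_one[of "2::real"] by simp
    have "ln (4::real) = 2 * ln 2" using ln_realpow[of 2 2] by simp
    thus "ln (4::real) \<le> 2" using l2 by simp
    have "ln (L / 2) \<le> L / 2 - 1" using L by (intro ln_le_minus_one) auto
    thus "ln L \<le> L / 2" using L l2 by (simp add: ln_div)
  qed auto
  finally show ?thesis using i unfolding L_def[symmetric] by simp
qed

text \<open>The increment of the squares is divided by the sum of the two nodes, which is at most \<open>2 * 2^i\<close>.
  It suffices to look at neighbours, since the nodes increase.\<close>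

lemma lambda_node_gap:
  assumes nm: "n < m" and i: "1 \<le> i" and m: "lambda_node \<beta> m \<le> 2 ^ i"
  shows "1 / 32 / (2 ^ i * real i) \<le> lambda_node \<beta> m - lambda_node \<beta> n"
proof -
  obtain k where k: "m = Suc k" "n \<le> k" using nm by (cases m) auto
  define a where "a = lambda_node \<beta> (Suc k)"
  define b where "b = lambda_node \<beta> k"
  have ab: "0 \<le> b" "b \<le> a" "a \<le> 2 ^ i" using lambda_node_nonneg lambda_node_mono[of k "Suc k"] m k by (auto simp: a_def b_def)
  have L: "1 \<le> log_shift (real (Suc k))" "log_shift (real (Suc k)) \<le> 8 * real i"
    using log_shift_ge_1[of "real (Suc k)"] log_shift_le_level[OF i m] k by auto
  have "1 / (16 * real i) \<le> 1 / (2 * log_shift (real (Suc k)))"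
    using L by (intro divide_left_mono mult_pos_pos) auto
  also have "\<dots> \<le> a\<^sup>2 - b\<^sup>2" unfolding a_def b_def by (rule lambda_node_square_step)
  also have "\<dots> = (a - b) * (a + b)" by (simp add: power2_eq_square algebra_simps)
  also have "\<dots> \<le> (a - b) * (2 * 2 ^ i)" using ab by (intro mult_left_mono) auto
  finally have "1 / 32 / (2 ^ i * real i) \<le> a - b" using i by (simp add: field_simps)
  also have "\<dots> \<le> a - lambda_node \<beta> n" using lambda_node_mono[OF k(2)] by (simp add: b_def)
  finally show ?thesis by (simp add: a_def k)
qed

text \<open>Between the nodes \<open>0\<close> and \<open>lambda_node \<beta> 1 \<ge> 3 / 4\<close> there is room for the point \<open>1 / 2\<close>.\<close>

lemma lambda_node_far_from_half: "1 / 4 \<le> \<bar>1 / 2 - lambda_node \<beta> n\<bar>"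
proof (cases n)
  case 0
  then show ?thesis by (simp add: lambda_node_0)
next
  case (Suc k)
  have L: "1 \<le> log_shift 1" "log_shift 1 \<le> 3 / 2"
  proof -
    show "1 \<le> log_shift 1" by (rule log_shift_ge_1) simp
    have "2 \<le> (exp 1 :: real)" using exp_ge_add_one_self[of "1::real"] by simp
    hence "1 / exp 1 \<le> (1 / 2 :: real)" by (intro divide_left_mono) auto
    moreover have "log_shift 1 \<le> log_shift 0 + 1 / exp 1" using log_shift_step[of 0] by simp
    moreover have "log_shift 0 = 1" by (simp add: log_shift_def)
    ultimately show "log_shift 1 \<le> 3 / 2" by linarith
  qed
  note B = log_powr_bounds[OF L(1)]
  have "(3 / 4)\<^sup>2 \<le> 1 / (3 / 2 :: real)" by (simp add: power2_eq_square)
  also have "\<dots> \<le> 1 / log_shift 1 powr (2 * \<beta>)" using B L by (intro divide_left_mono) auto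
  also have "\<dots> = (lambda_node \<beta> 1)\<^sup>2" by (simp add: lambda_node_square)
  finally have "3 / 4 \<le> lambda_node \<beta> 1" by (rule power2_le_imp_le) (rule lambda_node_nonneg)
  also have "\<dots> \<le> lambda_node \<beta> n" by (rule lambda_node_mono) (simp add: Suc)
  finally show ?thesis by simp
qed

end

text \<open>The imaginary part of the Fourier integral of an even real function is the integral of an odd
  function.\<close>

lemma fourier_transform_eq_cos_transform:
  assumes "has_cos_transform f g" and even: "\<And>x. f (- x) = f x"
  shows "fourier_transform (\<lambda>x. complex_of_real (f x)) = (\<lambda>\<xi>. complex_of_real (g \<xi>))"
proof
  fix \<xi> :: real
  have int: "integrable lborel f" using assms(1) by (simp add: has_cos_transform_def)
  have ic: "integrable lborel (\<lambda>x. f x * cos (2 * pi * \<xi> * x))" using integrable_mult_cos[OF int, of 0] by simp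
  have ints: "integrable lborel (\<lambda>x. f x * sin (2 * pi * \<xi> * x))" using integrable_mult_sin[OF int, of 0] by simp
  have eq: "complex_of_real (f x) * exp (- (2 * complex_of_real pi * \<i> * complex_of_real x * complex_of_real \<xi>))
      = complex_of_real (f x * cos (2 * pi * \<xi> * x)) - \<i> * complex_of_real (f x * sin (2 * pi * \<xi> * x))" for x
  proof -
    have "- (2 * complex_of_real pi * \<i> * complex_of_real x * complex_of_real \<xi>) = \<i> * complex_of_real (- (2 * pi * \<xi> * x))"
      by simp
    hence "exp (- (2 * complex_of_real pi * \<i> * complex_of_real x * complex_of_real \<xi>)) = cis (- (2 * pi * \<xi> * x))"
      by (simp only: cis_conv_exp)
    thus ?thesis by (simp add: complex_eq_iff)
  qed
  have "fourier_transform (\<lambda>x. complex_of_real (f x)) \<xi> = 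
     (LINT x|lborel. complex_of_real (f x * cos (2 * pi * \<xi> * x))) - (LINT x|lborel. \<i> * complex_of_real (f x * sin (2 * pi * \<xi> * x)))"
    unfolding fourier_transform_def eq
    by (intro Bochner_Integration.integral_diff integrable_mult_right integrable_of_real ic ints)
  also have "(LINT x|lborel. \<i> * complex_of_real (f x * sin (2 * pi * \<xi> * x))) = \<i> * complex_of_real (LINT x|lborel. f x * sin (2 * pi * \<xi> * x))"
    by (simp only: integral_mult_right_zero integral_complex_of_real)
  also have "(LINT x|lborel. f x * sin (2 * pi * \<xi> * x)) = 0"
    by (rule integral_odd_zero) (simp add: even)
  also have "(LINT x|lborel. complex_of_real (f x * cos (2 * pi * \<xi> * x))) = complex_of_real (g \<xi>)"
    using assms(1) unfolding has_cos_transform_def by (simp only: integral_complex_of_real)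
  finally show "fourier_transform (\<lambda>x. complex_of_real (f x)) \<xi> = complex_of_real (g \<xi>)" by simp
qed

section \<open>A self-dual function that vanishes at the nodes\<close>

theorem theorem1p1:
  fixes \<beta> :: real
  assumes "0 \<le> \<beta>" and "\<beta> \<le> 1 / 2"
  shows "\<exists>f :: real \<Rightarrow> real.
           continuous_on UNIV f \<and>
           (\<forall>x. f (- x) = f x) \<and>
           integrable lborel f \<and>
           integrable lborel (\<lambda>x. (f x)\<^sup>2) \<and>
           fourier_transform (\<lambda>x. complex_of_real (f x)) = (\<lambda>\<xi>. complex_of_real (f \<xi>)) \<and>
           (\<forall>n. f (lambda_node \<beta> n) = 0) \<and>
           f (1 / 2) = 1"
proof -
  define l where "l n = (case n of 0 \<Rightarrow> 1 / 2 | Suc k \<Rightarrow> lambda_node \<beta> k)" for n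
  have l_simps: "l 0 = 1 / 2" "l (Suc k) = lambda_node \<beta> k" for k by (simp_all add: l_def)
  have small: "1 / 32 / (2 ^ i * real i) \<le> 1 / 4" if "1 \<le> i" for i
  proof -
    have "1 * 1 \<le> 2 ^ i * real i" using that by (intro mult_mono) auto
    hence "1 / 32 / (2 ^ i * real i) \<le> 1 / 32 / 1" by (intro divide_left_mono) auto
    also have "\<dots> \<le> 1 / 4" by simp
    finally show ?thesis .
  qed
  have ordered: "1 / 32 / (2 ^ i * real i) \<le> \<bar>l n - l m\<bar>"
    if "n < m" "l m \<le> 2 ^ i" "1 \<le> i" for n m i
  proof -
    obtain m' where m': "m = Suc m'" using \<open>n < m\<close> by (cases m) auto
    show ?thesis
    proof (cases n)
      case 0
      have "1 / 4 \<le> \<bar>l n - l m\<bar>"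
        using lambda_node_far_from_half[OF assms] by (simp add: 0 m' l_simps)
      with small[OF \<open>1 \<le> i\<close>] show ?thesis by linarith
    next
      case (Suc n')
      have "1 / 32 / (2 ^ i * real i) \<le> l m - l n"
        using lambda_node_gap[OF assms, of n' m' i] that by (simp add: Suc m' l_simps)
      thus ?thesis by linarith
    qed
  qed
  have "\<exists>f. has_cos_transform f f \<and> (\<forall>m. f (l m) = (if m = 0 then 1 else 0))"
  proof (rule separated_nodes_interpolation[where c = "1 / 32"])
    show "0 \<le> l n" for n by (cases n) (simp_all add: l_simps lambda_node_nonneg)
    show "\<exists>n. l n = 0" using l_simps(2)[of 0] lambda_node_0 by metis
    show "1 / 32 / (2 ^ i * real i) \<le> \<bar>l n - l m\<bar>"
      if "n \<noteq> m" "l n \<le> 2 ^ i" "l m \<le> 2 ^ i" "1 \<le> i" for n m i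
      using that ordered[of n m i] ordered[of m n i] by (cases n m rule: linorder_cases) (auto simp: abs_minus_commute)
  qed simp
  then obtain f where f: "has_cos_transform f f" and val: "f (l m) = (if m = 0 then 1 else 0)" for m by blast
  have int: "integrable lborel f" using f by (simp add: has_cos_transform_def)
  have even: "f (- x) = f x" for x by (rule has_cos_transform_even[OF f])
  define B where "B = (LINT x|lborel. \<bar>f x\<bar>)"
  have bound: "\<bar>f x\<bar> \<le> B" for x unfolding B_def by (rule abs_le_integral_abs[OF f])
  have "integrable lborel (\<lambda>x. (f x)\<^sup>2)"
  proof (rule Bochner_Integration.integrable_bound)
    show "integrable lborel (\<lambda>x. B * f x)" using int by simp
    show "(\<lambda>x. (f x)\<^sup>2) \<in> borel_measurable lborel" using int by measurable
    have "norm ((f x)\<^sup>2) \<le> norm (B * f x)" for x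
      using mult_right_mono[OF bound[of x], of "\<bar>f x\<bar>"] bound[of x]
      by (simp add: power2_eq_square abs_mult)
    thus "AE x in lborel. norm ((f x)\<^sup>2) \<le> norm (B * f x)" by simp
  qed
  moreover have "f (lambda_node \<beta> n) = 0" for n using val[of "Suc n"] by (simp add: l_simps)
  moreover have "f (1 / 2) = 1" using val[of 0] by (simp add: l_simps)
  ultimately show ?thesis
    using has_cos_transform_continuous[OF f] even int fourier_transform_eq_cos_transform[OF f even]
    by blast
qed

end
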